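(* The following structure on the term category $\mathcal{T}$ of $\lambda_{\mathrm{eff}}$ is a $\lambda_{\mathrm{eff}}$-model. For each semantic signature $S$ (identified with a syntactic signature), $T_S$ is the strong monad given by the strong Kleisli triple with $T_S A = \mathtt{unit}\to A!S$, unit $x:A\vdash\lambda y.\mathtt{return}\ x:\mathtt{unit}\to A!S$, and strong Kleisli extension of $x:A_1\times A_2\vdash V:\mathtt{unit}\to B!S$ given by $x':A_1\times(\mathtt{unit}\to A_2!S)\vdash\lambda y.\,\mathtt{let}\ x_2\Leftarrow\pi_2\,x'\,\langle\rangle\ \mathtt{in}\ V[\langle\pi_1x',x_2\rangle/x]\,\langle\rangle$. Kleisli exponentials are $A\to B!S$. $\mathrm{handle}_{S,S',A}$ is $x:\mathcal{H}_S(A!S')\times(\mathtt{unit}\to(\mathtt{unit}\to A!S')!S)\vdash\lambda z.\,\mathtt{handle}\ \pi_2\,x\,\langle\rangle\ \mathtt{with}\ H\ \mathtt{to}\ r.\ r\,\langle\rangle$, where $H=\{\mathtt{op}(y,k)\mapsto\pi_{\mathtt{op}}(\pi_1x)\langle y,k\rangle\mid(\mathtt{op}:A_{\mathtt{op}}\to B_{\mathtt{op}})\in S\}$. Operations are interpreted as $x:A_{\mathtt{op}}\vdash\lambda y.\mathtt{op}(x):\mathtt{unit}\to B_{\mathtt{op}}!S$.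
   Context: $\lambda_{\mathrm{eff}}$: fine-grain CBV calculus with value types $A::=A\to C\mid\prod A_i$ ($\mathtt{unit}$ the empty product), computation types $A!\Sigma$, signatures finite sets of entries $\mathtt{op}:A\to B$ (operation with argument type $A$ and result type $B$; this arrow denotes an operation signature), values $x,\lambda x.M,\langle\dots\rangle,\pi_iV$, computations $V\,W$, $\mathtt{return}\ V$, $\mathtt{let}\ x\Leftarrow M\ \mathtt{in}\ N$, $\mathtt{op}(V)$, $\mathtt{handle}\ M\ \mathtt{with}\ H\ \mathtt{to}\ x.N$, and handlers finite sets of clauses $\mathtt{op}(x,k)\mapsto M_{\mathtt{op}}$; equational theory the least congruence containing $\beta\eta$ for functions and products, monad laws, and the three handler laws (handling $\mathtt{return}\ V$ gives $M[V/x]$; handling a $\mathtt{let}$ gives nested handles; handling $\mathtt{op}(V)$ gives $M_{\mathtt{op}}[V/x,\lambda x.M/k]$). The term category $\mathcal{T}$ has value types as objects and value terms $x:A\vdash V:B$ modulo provable equality as morphisms, identities $x$, composition by substitution; it is cartesian with products given by product types. $\mathcal{H}_S(X)$ denotes the product type $\prod_{(\mathtt{op}:A_{\mathtt{op}}\to B_{\mathtt{op}})\in S}(A_{\mathtt{op}}\times(B_{\mathtt{op}}\to X)\to X)$ for a computation type $X$. A $\lambda_{\mathrm{eff}}$-model: cartesian category with strong monads $T_S$ per semantic signature, Kleisli exponentials, morphisms $[\![\mathtt{op}]\!]_S:A_{\mathtt{op}}\to T_SB_{\mathtt{op}}$, and $\mathrm{handle}_{S,S',X}:\mathcal{H}_S(X)\times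 T_ST_{S'}X\to T_{S'}X$ satisfying $\mathrm{handle}\circ(\mathrm{id}\times\eta)=\pi_2$, $\mathrm{handle}\circ(\mathrm{id}\times\mu)=\mathrm{handle}\circ(\mathrm{id}\times T_S\mathrm{handle})\circ\langle\pi_1,\mathrm{st}\rangle$, $\mathrm{handle}\circ(\mathrm{id}\times a_{\mathtt{op}})=\mathrm{ev}\circ(\pi_{\mathtt{op}}\times\mathrm{id})$ with $a_{\mathtt{op}}=T_S\mathrm{ev}\circ\mathrm{st}\circ\mathrm{swap}\circ([\![\mathtt{op}]\!]_S\times\mathrm{id})$. *)

theory Defs
  imports "HOL-Library.Finite_Map"
begin

section \<open>Syntax of the calculus\<close>

text \<open>The type variable \<open>'l\<close> is the type of operation names. Products are indexed by finite sets
  of indices, which are numbers (used for binary products) or operation names (used for the product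
  over a signature). Signatures are finite maps, so a name has at most one entry \<open>op : A \<rightarrow> B\<close> in a
  signature, and \<open>A\<^sub>o\<^sub>p\<close>, \<open>B\<^sub>o\<^sub>p\<close> make sense.\<close>

datatype 'l idx = Num nat | Lab 'l

datatype 'l ty = TFun "'l ty" "'l cty" | TProd "('l idx, 'l ty) fmap"
  and 'l cty = CTy "'l ty" "('l, 'l ty \<times> 'l ty) fmap"

type_synonym 'l sig = "('l, 'l ty \<times> 'l ty) fmap"

text \<open>Terms are in de Bruijn form. \<open>VLam\<close>, the body of \<open>CLet\<close> and the return clause of \<open>CHandle\<close>
  (its last argument) bind one variable. An operation clause \<open>op(x,k) \<mapsto> M\<close> binds two: in \<open>M\<close>,
  index 0 is \<open>k\<close> and index 1 is \<open>x\<close>.\<close>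

datatype 'l val =
    VVar nat
  | VLam "'l comp"
  | VTup "('l idx, 'l val) fmap"
  | VPrj "'l idx" "'l val"
  and 'l comp =
    CApp "'l val" "'l val"
  | CRet "'l val"
  | CLet "'l comp" "'l comp"
  | COp 'l "'l val"
  | CHandle "'l comp" "('l, 'l comp) fmap" "'l comp"

definition two :: "'a \<Rightarrow> 'a \<Rightarrow> ('l idx, 'a) fmap" where
  "two a b = fmap_of_list [(Num 1, a), (Num 2, b)]"

context includes fmap.lifting
begin

lift_definition op_family :: "('l, 'a) fmap \<Rightarrow> ('l idx, 'a) fmap"
  is "\<lambda>m i. case i of Num n \<Rightarrow> None | Lab l \<Rightarrow> m l"
proof -
  fix m :: "'l \<Rightarrow> 'a option"
  assume "finite (dom m)"
  moreover have "dom (\<lambda>i. case i of Num n \<Rightarrow> None | Lab l \<Rightarrow> m l) \<subseteq> Lab ` dom m"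
    by (auto split: idx.splits intro!: imageI)
  ultimately show "finite (dom (\<lambda>i. case i of Num n \<Rightarrow> None | Lab l \<Rightarrow> m l))"
    by (meson finite_imageI finite_subset)
qed

end

abbreviation TUnit :: "'l ty" where "TUnit \<equiv> TProd fmempty"
abbreviation TPair :: "'l ty \<Rightarrow> 'l ty \<Rightarrow> 'l ty" where "TPair A B \<equiv> TProd (two A B)"
abbreviation VUnit :: "'l val" where "VUnit \<equiv> VTup fmempty"
abbreviation VPair :: "'l val \<Rightarrow> 'l val \<Rightarrow> 'l val" where "VPair V W \<equiv> VTup (two V W)"
abbreviation VFst :: "'l val \<Rightarrow> 'l val" where "VFst V \<equiv> VPrj (Num 1) V"
abbreviation VSnd :: "'l val \<Rightarrow> 'l val" where "VSnd V \<equiv> VPrj (Num 2) V"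


subsection \<open>Renaming and simultaneous substitution\<close>

definition up_ren :: "(nat \<Rightarrow> nat) \<Rightarrow> nat \<Rightarrow> nat" where
  "up_ren r = case_nat 0 (\<lambda>n. Suc (r n))"

primrec ren_val :: "'l val \<Rightarrow> (nat \<Rightarrow> nat) \<Rightarrow> 'l val"
  and ren_comp :: "'l comp \<Rightarrow> (nat \<Rightarrow> nat) \<Rightarrow> 'l comp" where
  "ren_val (VVar n) = (\<lambda>r. VVar (r n))"
| "ren_val (VLam M) = (\<lambda>r. VLam (ren_comp M (up_ren r)))"
| "ren_val (VTup Vs) = (\<lambda>r. VTup (fmmap (\<lambda>V. ren_val V r) Vs))"
| "ren_val (VPrj i V) = (\<lambda>r. VPrj i (ren_val V r))"
| "ren_comp (CApp V W) = (\<lambda>r. CApp (ren_val V r) (ren_val W r))"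
| "ren_comp (CRet V) = (\<lambda>r. CRet (ren_val V r))"
| "ren_comp (CLet M N) = (\<lambda>r. CLet (ren_comp M r) (ren_comp N (up_ren r)))"
| "ren_comp (COp l V) = (\<lambda>r. COp l (ren_val V r))"
| "ren_comp (CHandle M H N) = (\<lambda>r. CHandle (ren_comp M r)
     (fmmap (\<lambda>P. ren_comp P (up_ren (up_ren r))) H) (ren_comp N (up_ren r)))"

definition up_sub :: "(nat \<Rightarrow> 'l val) \<Rightarrow> nat \<Rightarrow> 'l val" where
  "up_sub s = case_nat (VVar 0) (\<lambda>n. ren_val (s n) Suc)"

primrec sub_val :: "'l val \<Rightarrow> (nat \<Rightarrow> 'l val) \<Rightarrow> 'l val"
  and sub_comp :: "'l comp \<Rightarrow> (nat \<Rightarrow> 'l val) \<Rightarrow> 'l comp" where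
  "sub_val (VVar n) = (\<lambda>s. s n)"
| "sub_val (VLam M) = (\<lambda>s. VLam (sub_comp M (up_sub s)))"
| "sub_val (VTup Vs) = (\<lambda>s. VTup (fmmap (\<lambda>V. sub_val V s) Vs))"
| "sub_val (VPrj i V) = (\<lambda>s. VPrj i (sub_val V s))"
| "sub_comp (CApp V W) = (\<lambda>s. CApp (sub_val V s) (sub_val W s))"
| "sub_comp (CRet V) = (\<lambda>s. CRet (sub_val V s))"
| "sub_comp (CLet M N) = (\<lambda>s. CLet (sub_comp M s) (sub_comp N (up_sub s)))"
| "sub_comp (COp l V) = (\<lambda>s. COp l (sub_val V s))"
| "sub_comp (CHandle M H N) = (\<lambda>s. CHandle (sub_comp M s)
     (fmmap (\<lambda>P. sub_comp P (up_sub (up_sub s))) H) (sub_comp N (up_sub s)))"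

text \<open>\<open>inst M V\<close> is \<open>M[V/x]\<close>, and \<open>inst2 M V W\<close> is \<open>M[V/x, W/k]\<close> for an operation clause \<open>M\<close>.\<close>

definition inst :: "'l comp \<Rightarrow> 'l val \<Rightarrow> 'l comp" where
  "inst M V = sub_comp M (case_nat V VVar)"

definition inst2 :: "'l comp \<Rightarrow> 'l val \<Rightarrow> 'l val \<Rightarrow> 'l comp" where
  "inst2 M V W = sub_comp M (case_nat W (case_nat V VVar))"

abbreviation wk_val :: "'l val \<Rightarrow> 'l val" where "wk_val V \<equiv> ren_val V Suc"
abbreviation wk_comp1 :: "'l comp \<Rightarrow> 'l comp" where "wk_comp1 N \<equiv> ren_comp N (up_ren Suc)"
abbreviation wk_handler :: "('l, 'l comp) fmap \<Rightarrow> ('l, 'l comp) fmap" where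
  "wk_handler H \<equiv> fmmap (\<lambda>P. ren_comp P (up_ren (up_ren Suc))) H"


section \<open>Typing and the equational theory\<close>

inductive
  has_vty :: "'l ty list \<Rightarrow> 'l val \<Rightarrow> 'l ty \<Rightarrow> bool"
    (\<open>(_ \<turnstile>\<^sub>v _ : _)\<close> [50, 50, 50] 50) and
  has_cty :: "'l ty list \<Rightarrow> 'l comp \<Rightarrow> 'l cty \<Rightarrow> bool"
    (\<open>(_ \<turnstile>\<^sub>c _ : _)\<close> [50, 50, 50] 50)
where
  ty_var: "n < length \<Gamma> \<Longrightarrow> \<Gamma> \<turnstile>\<^sub>v VVar n : \<Gamma> ! n"
| ty_lam: "A # \<Gamma> \<turnstile>\<^sub>c M : C \<Longrightarrow> \<Gamma> \<turnstile>\<^sub>v VLam M : TFun A C"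
| ty_tup: "fmdom Vs = fmdom As \<Longrightarrow>
    (\<And>i V A. fmlookup Vs i = Some V \<Longrightarrow> fmlookup As i = Some A \<Longrightarrow> \<Gamma> \<turnstile>\<^sub>v V : A) \<Longrightarrow>
    \<Gamma> \<turnstile>\<^sub>v VTup Vs : TProd As"
| ty_prj: "\<Gamma> \<turnstile>\<^sub>v V : TProd As \<Longrightarrow> fmlookup As i = Some A \<Longrightarrow> \<Gamma> \<turnstile>\<^sub>v VPrj i V : A"
| ty_app: "\<Gamma> \<turnstile>\<^sub>v V : TFun A C \<Longrightarrow> \<Gamma> \<turnstile>\<^sub>v W : A \<Longrightarrow> \<Gamma> \<turnstile>\<^sub>c CApp V W : C"
| ty_ret: "\<Gamma> \<turnstile>\<^sub>v V : A \<Longrightarrow> \<Gamma> \<turnstile>\<^sub>c CRet V : CTy A S"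
| ty_let: "\<Gamma> \<turnstile>\<^sub>c M : CTy A S \<Longrightarrow> A # \<Gamma> \<turnstile>\<^sub>c N : CTy B S \<Longrightarrow> \<Gamma> \<turnstile>\<^sub>c CLet M N : CTy B S"
| ty_op: "fmlookup S l = Some (A, B) \<Longrightarrow> \<Gamma> \<turnstile>\<^sub>v V : A \<Longrightarrow> \<Gamma> \<turnstile>\<^sub>c COp l V : CTy B S"
| ty_handle: "\<Gamma> \<turnstile>\<^sub>c M : CTy A S \<Longrightarrow> fmdom H = fmdom S \<Longrightarrow>
    (\<And>l A' B' P. fmlookup S l = Some (A', B') \<Longrightarrow> fmlookup H l = Some P \<Longrightarrow>
      TFun B' C # A' # \<Gamma> \<turnstile>\<^sub>c P : C) \<Longrightarrow>
    A # \<Gamma> \<turnstile>\<^sub>c N : C \<Longrightarrow>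
    \<Gamma> \<turnstile>\<^sub>c CHandle M H N : C"

inductive
  veq :: "'l ty list \<Rightarrow> 'l val \<Rightarrow> 'l val \<Rightarrow> 'l ty \<Rightarrow> bool"
    (\<open>(_ \<turnstile>\<^sub>v _ \<approx> _ : _)\<close> [50, 50, 50, 50] 50) and
  ceq :: "'l ty list \<Rightarrow> 'l comp \<Rightarrow> 'l comp \<Rightarrow> 'l cty \<Rightarrow> bool"
    (\<open>(_ \<turnstile>\<^sub>c _ \<approx> _ : _)\<close> [50, 50, 50, 50] 50)
where
  veq_refl: "\<Gamma> \<turnstile>\<^sub>v V : A \<Longrightarrow> \<Gamma> \<turnstile>\<^sub>v V \<approx> V : A"
| veq_sym: "\<Gamma> \<turnstile>\<^sub>v V \<approx> W : A \<Longrightarrow> \<Gamma> \<turnstile>\<^sub>v W \<approx> V : A"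
| veq_trans: "\<Gamma> \<turnstile>\<^sub>v U \<approx> V : A \<Longrightarrow> \<Gamma> \<turnstile>\<^sub>v V \<approx> W : A \<Longrightarrow> \<Gamma> \<turnstile>\<^sub>v U \<approx> W : A"
| ceq_refl: "\<Gamma> \<turnstile>\<^sub>c M : C \<Longrightarrow> \<Gamma> \<turnstile>\<^sub>c M \<approx> M : C"
| ceq_sym: "\<Gamma> \<turnstile>\<^sub>c M \<approx> N : C \<Longrightarrow> \<Gamma> \<turnstile>\<^sub>c N \<approx> M : C"
| ceq_trans: "\<Gamma> \<turnstile>\<^sub>c L \<approx> M : C \<Longrightarrow> \<Gamma> \<turnstile>\<^sub>c M \<approx> N : C \<Longrightarrow> \<Gamma> \<turnstile>\<^sub>c L \<approx> N : C"
| cong_lam: "A # \<Gamma> \<turnstile>\<^sub>c M \<approx> M' : C \<Longrightarrow> \<Gamma> \<turnstile>\<^sub>v VLam M \<approx> VLam M' : TFun A C"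
| cong_tup: "fmdom Vs = fmdom As \<Longrightarrow> fmdom Vs' = fmdom As \<Longrightarrow>
    (\<And>i V V' A. fmlookup Vs i = Some V \<Longrightarrow> fmlookup Vs' i = Some V' \<Longrightarrow> fmlookup As i = Some A \<Longrightarrow>
      \<Gamma> \<turnstile>\<^sub>v V \<approx> V' : A) \<Longrightarrow>
    \<Gamma> \<turnstile>\<^sub>v VTup Vs \<approx> VTup Vs' : TProd As"
| cong_prj: "\<Gamma> \<turnstile>\<^sub>v V \<approx> V' : TProd As \<Longrightarrow> fmlookup As i = Some A \<Longrightarrow>
    \<Gamma> \<turnstile>\<^sub>v VPrj i V \<approx> VPrj i V' : A"
| cong_app: "\<Gamma> \<turnstile>\<^sub>v V \<approx> V' : TFun A C \<Longrightarrow> \<Gamma> \<turnstile>\<^sub>v W \<approx> W' : A \<Longrightarrow>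
    \<Gamma> \<turnstile>\<^sub>c CApp V W \<approx> CApp V' W' : C"
| cong_ret: "\<Gamma> \<turnstile>\<^sub>v V \<approx> V' : A \<Longrightarrow> \<Gamma> \<turnstile>\<^sub>c CRet V \<approx> CRet V' : CTy A S"
| cong_let: "\<Gamma> \<turnstile>\<^sub>c M \<approx> M' : CTy A S \<Longrightarrow> A # \<Gamma> \<turnstile>\<^sub>c N \<approx> N' : CTy B S \<Longrightarrow>
    \<Gamma> \<turnstile>\<^sub>c CLet M N \<approx> CLet M' N' : CTy B S"
| cong_op: "fmlookup S l = Some (A, B) \<Longrightarrow> \<Gamma> \<turnstile>\<^sub>v V \<approx> V' : A \<Longrightarrow>
    \<Gamma> \<turnstile>\<^sub>c COp l V \<approx> COp l V' : CTy B S"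
| cong_handle: "\<Gamma> \<turnstile>\<^sub>c M \<approx> M' : CTy A S \<Longrightarrow> fmdom H = fmdom S \<Longrightarrow> fmdom H' = fmdom S \<Longrightarrow>
    (\<And>l A' B' P P'. fmlookup S l = Some (A', B') \<Longrightarrow>
      fmlookup H l = Some P \<Longrightarrow> fmlookup H' l = Some P' \<Longrightarrow>
      TFun B' C # A' # \<Gamma> \<turnstile>\<^sub>c P \<approx> P' : C) \<Longrightarrow>
    A # \<Gamma> \<turnstile>\<^sub>c N \<approx> N' : C \<Longrightarrow>
    \<Gamma> \<turnstile>\<^sub>c CHandle M H N \<approx> CHandle M' H' N' : C"
| beta_fun: "A # \<Gamma> \<turnstile>\<^sub>c M : C \<Longrightarrow> \<Gamma> \<turnstile>\<^sub>v V : A \<Longrightarrow> \<Gamma> \<turnstile>\<^sub>c CApp (VLam M) V \<approx> inst M V : C"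
| eta_fun: "\<Gamma> \<turnstile>\<^sub>v V : TFun A C \<Longrightarrow> \<Gamma> \<turnstile>\<^sub>v V \<approx> VLam (CApp (wk_val V) (VVar 0)) : TFun A C"
| beta_prod: "\<Gamma> \<turnstile>\<^sub>v VTup Vs : TProd As \<Longrightarrow> fmlookup Vs i = Some V \<Longrightarrow> fmlookup As i = Some A \<Longrightarrow>
    \<Gamma> \<turnstile>\<^sub>v VPrj i (VTup Vs) \<approx> V : A"
| eta_prod: "\<Gamma> \<turnstile>\<^sub>v V : TProd As \<Longrightarrow>
    \<Gamma> \<turnstile>\<^sub>v V \<approx> VTup (fmmap_keys (\<lambda>i _. VPrj i V) As) : TProd As"
| let_ret: "\<Gamma> \<turnstile>\<^sub>v V : A \<Longrightarrow> A # \<Gamma> \<turnstile>\<^sub>c N : CTy B S \<Longrightarrow>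
    \<Gamma> \<turnstile>\<^sub>c CLet (CRet V) N \<approx> inst N V : CTy B S"
| let_eta: "\<Gamma> \<turnstile>\<^sub>c M : CTy A S \<Longrightarrow> \<Gamma> \<turnstile>\<^sub>c CLet M (CRet (VVar 0)) \<approx> M : CTy A S"
| let_assoc: "\<Gamma> \<turnstile>\<^sub>c L : CTy A S \<Longrightarrow> A # \<Gamma> \<turnstile>\<^sub>c M : CTy B S \<Longrightarrow> B # \<Gamma> \<turnstile>\<^sub>c N : CTy D S \<Longrightarrow>
    \<Gamma> \<turnstile>\<^sub>c CLet (CLet L M) N \<approx> CLet L (CLet M (wk_comp1 N)) : CTy D S"
| handle_ret: "\<Gamma> \<turnstile>\<^sub>v V : A \<Longrightarrow> fmdom H = fmdom S \<Longrightarrow>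
    (\<And>l A' B' P. fmlookup S l = Some (A', B') \<Longrightarrow> fmlookup H l = Some P \<Longrightarrow>
      TFun B' C # A' # \<Gamma> \<turnstile>\<^sub>c P : C) \<Longrightarrow>
    A # \<Gamma> \<turnstile>\<^sub>c N : C \<Longrightarrow>
    \<Gamma> \<turnstile>\<^sub>c CHandle (CRet V) H N \<approx> inst N V : C"
| handle_let: "\<Gamma> \<turnstile>\<^sub>c L : CTy A S \<Longrightarrow> A # \<Gamma> \<turnstile>\<^sub>c M : CTy B S \<Longrightarrow> fmdom H = fmdom S \<Longrightarrow>
    (\<And>l A' B' P. fmlookup S l = Some (A', B') \<Longrightarrow> fmlookup H l = Some P \<Longrightarrow>
      TFun B' C # A' # \<Gamma> \<turnstile>\<^sub>c P : C) \<Longrightarrow>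
    B # \<Gamma> \<turnstile>\<^sub>c N : C \<Longrightarrow>
    \<Gamma> \<turnstile>\<^sub>c CHandle (CLet L M) H N \<approx> CHandle L H (CHandle M (wk_handler H) (wk_comp1 N)) : C"
| handle_op: "fmlookup S l = Some (A, B) \<Longrightarrow> \<Gamma> \<turnstile>\<^sub>v V : A \<Longrightarrow> fmdom H = fmdom S \<Longrightarrow>
    (\<And>l A' B' P. fmlookup S l = Some (A', B') \<Longrightarrow> fmlookup H l = Some P \<Longrightarrow>
      TFun B' C # A' # \<Gamma> \<turnstile>\<^sub>c P : C) \<Longrightarrow>
    B # \<Gamma> \<turnstile>\<^sub>c N : C \<Longrightarrow> fmlookup H l = Some P \<Longrightarrow>
    \<Gamma> \<turnstile>\<^sub>c CHandle (COp l V) H N \<approx> inst2 P V (VLam N) : C"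


section \<open>Cartesian categories\<close>

text \<open>\<open>Prd As\<close> is the chosen product of a finite family of objects, \<open>Prj As i\<close> its projections,
  and \<open>Tpl D fs\<close> the tupling of a finite family of arrows with domain \<open>D\<close>.\<close>

record ('o, 'm, 'l) cart =
  Obj :: "'o set"
  Arr :: "'m set"
  Dom :: "'m \<Rightarrow> 'o"
  Cod :: "'m \<Rightarrow> 'o"
  Idn :: "'o \<Rightarrow> 'm"
  Cmp :: "'m \<Rightarrow> 'm \<Rightarrow> 'm"  (infixr \<open>\<odot>\<index>\<close> 75)
  Prd :: "('l idx, 'o) fmap \<Rightarrow> 'o"
  Prj :: "('l idx, 'o) fmap \<Rightarrow> 'l idx \<Rightarrow> 'm"
  Tpl :: "'o \<Rightarrow> ('l idx, 'm) fmap \<Rightarrow> 'm"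

definition Hom :: "('o, 'm, 'l) cart \<Rightarrow> 'o \<Rightarrow> 'o \<Rightarrow> 'm set" where
  "Hom C A B = {f \<in> Arr C. Dom C f = A \<and> Cod C f = B}"

definition Bin :: "('o, 'm, 'l) cart \<Rightarrow> 'o \<Rightarrow> 'o \<Rightarrow> 'o"  (infixr \<open>\<otimes>\<index>\<close> 70) where
  "A \<otimes>\<^bsub>C\<^esub> B = Prd C (two A B)"

definition One :: "('o, 'm, 'l) cart \<Rightarrow> 'o"  (\<open>\<one>\<index>\<close>) where
  "\<one>\<^bsub>C\<^esub> = Prd C fmempty"

definition Fst :: "('o, 'm, 'l) cart \<Rightarrow> 'o \<Rightarrow> 'o \<Rightarrow> 'm" where
  "Fst C A B = Prj C (two A B) (Num 1)"

definition Snd :: "('o, 'm, 'l) cart \<Rightarrow> 'o \<Rightarrow> 'o \<Rightarrow> 'm" where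
  "Snd C A B = Prj C (two A B) (Num 2)"

definition Bang :: "('o, 'm, 'l) cart \<Rightarrow> 'o \<Rightarrow> 'm" where
  "Bang C A = Tpl C A fmempty"

definition Pairing :: "('o, 'm, 'l) cart \<Rightarrow> 'm \<Rightarrow> 'm \<Rightarrow> 'm"  (\<open>\<langle>_, _\<rangle>\<index>\<close>) where
  "\<langle>f, g\<rangle>\<^bsub>C\<^esub> = Tpl C (Dom C f) (two f g)"

definition Times :: "('o, 'm, 'l) cart \<Rightarrow> 'm \<Rightarrow> 'm \<Rightarrow> 'm"  (infixr \<open>\<otimes>\<otimes>\<index>\<close> 80) where
  "f \<otimes>\<otimes>\<^bsub>C\<^esub> g = \<langle>f \<odot>\<^bsub>C\<^esub> Fst C (Dom C f) (Dom C g), g \<odot>\<^bsub>C\<^esub> Snd C (Dom C f) (Dom C g)\<rangle>\<^bsub>C\<^esub>"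

definition Swap :: "('o, 'm, 'l) cart \<Rightarrow> 'o \<Rightarrow> 'o \<Rightarrow> 'm" where
  "Swap C A B = \<langle>Snd C A B, Fst C A B\<rangle>\<^bsub>C\<^esub>"

definition Assoc :: "('o, 'm, 'l) cart \<Rightarrow> 'o \<Rightarrow> 'o \<Rightarrow> 'o \<Rightarrow> 'm" where
  "Assoc C A B D =
     \<langle>Fst C A B \<odot>\<^bsub>C\<^esub> Fst C (A \<otimes>\<^bsub>C\<^esub> B) D, Snd C A B \<otimes>\<otimes>\<^bsub>C\<^esub> Idn C D\<rangle>\<^bsub>C\<^esub>"

locale cartesian_category =
  fixes C :: "('o, 'm, 'l) cart" (structure)
  assumes dom_obj: "f \<in> Arr C \<Longrightarrow> Dom C f \<in> Obj C"
    and cod_obj: "f \<in> Arr C \<Longrightarrow> Cod C f \<in> Obj C"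
    and id_hom: "A \<in> Obj C \<Longrightarrow> Idn C A \<in> Hom C A A"
    and comp_hom: "f \<in> Hom C A B \<Longrightarrow> g \<in> Hom C B D \<Longrightarrow> g \<odot> f \<in> Hom C A D"
    and id_left: "f \<in> Hom C A B \<Longrightarrow> Idn C B \<odot> f = f"
    and id_right: "f \<in> Hom C A B \<Longrightarrow> f \<odot> Idn C A = f"
    and comp_assoc: "f \<in> Hom C A B \<Longrightarrow> g \<in> Hom C B D \<Longrightarrow> h \<in> Hom C D E \<Longrightarrow>
      (h \<odot> g) \<odot> f = h \<odot> (g \<odot> f)"
    and prod_obj: "fmpred (\<lambda>_ A. A \<in> Obj C) As \<Longrightarrow> Prd C As \<in> Obj C"
    and proj_hom: "fmpred (\<lambda>_ A. A \<in> Obj C) As \<Longrightarrow> fmlookup As i = Some A \<Longrightarrow>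
      Prj C As i \<in> Hom C (Prd C As) A"
    and tuple_hom: "D \<in> Obj C \<Longrightarrow> fmpred (\<lambda>_ f. f \<in> Arr C \<and> Dom C f = D) fs \<Longrightarrow>
      Tpl C D fs \<in> Hom C D (Prd C (fmmap (Cod C) fs))"
    and proj_tuple: "D \<in> Obj C \<Longrightarrow> fmpred (\<lambda>_ f. f \<in> Arr C \<and> Dom C f = D) fs \<Longrightarrow>
      fmlookup fs i = Some f \<Longrightarrow> Prj C (fmmap (Cod C) fs) i \<odot> Tpl C D fs = f"
    and tuple_unique: "D \<in> Obj C \<Longrightarrow> fmpred (\<lambda>_ f. f \<in> Arr C \<and> Dom C f = D) fs \<Longrightarrow>
      h \<in> Hom C D (Prd C (fmmap (Cod C) fs)) \<Longrightarrow>
      (\<And>i f. fmlookup fs i = Some f \<Longrightarrow> Prj C (fmmap (Cod C) fs) i \<odot> h = f) \<Longrightarrow>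
      h = Tpl C D fs"


section \<open>Strong monads and strong Kleisli triples\<close>

record ('o, 'm) smonad =
  TO :: "'o \<Rightarrow> 'o"
  TM :: "'m \<Rightarrow> 'm"
  Eta :: "'o \<Rightarrow> 'm"
  Mu :: "'o \<Rightarrow> 'm"
  Str :: "'o \<Rightarrow> 'o \<Rightarrow> 'm"

text \<open>The strength has components \<open>Str T A B : A \<times> T B \<rightarrow> T (A \<times> B)\<close>.\<close>

locale strong_monad = cartesian_category C
  for C :: "('o, 'm, 'l) cart" (structure) +
  fixes T :: "('o, 'm) smonad"
  assumes T_obj: "A \<in> Obj C \<Longrightarrow> TO T A \<in> Obj C"
    and T_hom: "f \<in> Hom C A B \<Longrightarrow> TM T f \<in> Hom C (TO T A) (TO T B)"
    and T_id: "A \<in> Obj C \<Longrightarrow> TM T (Idn C A) = Idn C (TO T A)"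
    and T_comp: "f \<in> Hom C A B \<Longrightarrow> g \<in> Hom C B D \<Longrightarrow> TM T (g \<odot> f) = TM T g \<odot> TM T f"
    and eta_hom: "A \<in> Obj C \<Longrightarrow> Eta T A \<in> Hom C A (TO T A)"
    and eta_nat: "f \<in> Hom C A B \<Longrightarrow> TM T f \<odot> Eta T A = Eta T B \<odot> f"
    and mu_hom: "A \<in> Obj C \<Longrightarrow> Mu T A \<in> Hom C (TO T (TO T A)) (TO T A)"
    and mu_nat: "f \<in> Hom C A B \<Longrightarrow> TM T f \<odot> Mu T A = Mu T B \<odot> TM T (TM T f)"
    and mu_eta: "A \<in> Obj C \<Longrightarrow> Mu T A \<odot> Eta T (TO T A) = Idn C (TO T A)"
    and mu_T_eta: "A \<in> Obj C \<Longrightarrow> Mu T A \<odot> TM T (Eta T A) = Idn C (TO T A)"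
    and mu_mu: "A \<in> Obj C \<Longrightarrow> Mu T A \<odot> Mu T (TO T A) = Mu T A \<odot> TM T (Mu T A)"
    and str_hom: "A \<in> Obj C \<Longrightarrow> B \<in> Obj C \<Longrightarrow>
      Str T A B \<in> Hom C (A \<otimes> TO T B) (TO T (A \<otimes> B))"
    and str_nat: "f \<in> Hom C A A' \<Longrightarrow> g \<in> Hom C B B' \<Longrightarrow>
      TM T (f \<otimes>\<otimes> g) \<odot> Str T A B = Str T A' B' \<odot> (f \<otimes>\<otimes> TM T g)"
    and str_unit: "A \<in> Obj C \<Longrightarrow> TM T (Snd C \<one> A) \<odot> Str T \<one> A = Snd C \<one> (TO T A)"
    and str_assoc: "A \<in> Obj C \<Longrightarrow> B \<in> Obj C \<Longrightarrow> D \<in> Obj C \<Longrightarrow>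
      TM T (Assoc C A B D) \<odot> Str T (A \<otimes> B) D =
      Str T A (B \<otimes> D) \<odot> (Idn C A \<otimes>\<otimes> Str T B D) \<odot> Assoc C A B (TO T D)"
    and str_eta: "A \<in> Obj C \<Longrightarrow> B \<in> Obj C \<Longrightarrow>
      Str T A B \<odot> (Idn C A \<otimes>\<otimes> Eta T B) = Eta T (A \<otimes> B)"
    and str_mu: "A \<in> Obj C \<Longrightarrow> B \<in> Obj C \<Longrightarrow>
      Str T A B \<odot> (Idn C A \<otimes>\<otimes> Mu T B) =
      Mu T (A \<otimes> B) \<odot> TM T (Str T A B) \<odot> Str T A (TO T B)"

text \<open>\<open>KExt K A\<^sub>1 A\<^sub>2 B\<close> takes \<open>f : A\<^sub>1 \<times> A\<^sub>2 \<rightarrow> T B\<close> to its strong Kleisli extension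
  \<open>A\<^sub>1 \<times> T A\<^sub>2 \<rightarrow> T B\<close>.\<close>

record ('o, 'm) ktriple =
  KO :: "'o \<Rightarrow> 'o"
  KEta :: "'o \<Rightarrow> 'm"
  KExt :: "'o \<Rightarrow> 'o \<Rightarrow> 'o \<Rightarrow> 'm \<Rightarrow> 'm"

locale strong_kleisli_triple = cartesian_category C
  for C :: "('o, 'm, 'l) cart" (structure) +
  fixes K :: "('o, 'm) ktriple"
  assumes K_obj: "A \<in> Obj C \<Longrightarrow> KO K A \<in> Obj C"
    and K_eta_hom: "A \<in> Obj C \<Longrightarrow> KEta K A \<in> Hom C A (KO K A)"
    and K_ext_hom: "G \<in> Obj C \<Longrightarrow> A \<in> Obj C \<Longrightarrow> B \<in> Obj C \<Longrightarrow> f \<in> Hom C (G \<otimes> A) (KO K B) \<Longrightarrow>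
      KExt K G A B f \<in> Hom C (G \<otimes> KO K A) (KO K B)"
    and K_ext_nat: "h \<in> Hom C G' G \<Longrightarrow> A \<in> Obj C \<Longrightarrow> B \<in> Obj C \<Longrightarrow> f \<in> Hom C (G \<otimes> A) (KO K B) \<Longrightarrow>
      KExt K G' A B (f \<odot> (h \<otimes>\<otimes> Idn C A)) = KExt K G A B f \<odot> (h \<otimes>\<otimes> Idn C (KO K A))"
    and K_ext_eta: "G \<in> Obj C \<Longrightarrow> A \<in> Obj C \<Longrightarrow> B \<in> Obj C \<Longrightarrow> f \<in> Hom C (G \<otimes> A) (KO K B) \<Longrightarrow>
      KExt K G A B f \<odot> (Idn C G \<otimes>\<otimes> KEta K A) = f"
    and K_eta_ext: "G \<in> Obj C \<Longrightarrow> A \<in> Obj C \<Longrightarrow>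
      KExt K G A A (KEta K A \<odot> Snd C G A) = Snd C G (KO K A)"
    and K_ext_ext: "G \<in> Obj C \<Longrightarrow> A \<in> Obj C \<Longrightarrow> B \<in> Obj C \<Longrightarrow> D \<in> Obj C \<Longrightarrow>
      f \<in> Hom C (G \<otimes> A) (KO K B) \<Longrightarrow> g \<in> Hom C (G \<otimes> B) (KO K D) \<Longrightarrow>
      KExt K G A D (KExt K G B D g \<odot> \<langle>Fst C G A, f\<rangle>) =
      KExt K G B D g \<odot> \<langle>Fst C G (KO K A), KExt K G A B f\<rangle>"

text \<open>Unparametrised Kleisli extension is the case \<open>A\<^sub>1 = \<one>\<close>; functorial action, multiplication and
  strength are the extensions of \<open>\<eta> \<circ> f\<close>, \<open>id\<close> and \<open>\<eta>\<close> respectively.\<close>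

definition ext1 :: "('o, 'm, 'l) cart \<Rightarrow> ('o, 'm) ktriple \<Rightarrow> 'o \<Rightarrow> 'o \<Rightarrow> 'm \<Rightarrow> 'm" where
  "ext1 C K A B f =
     KExt K (One C) A B (f \<odot>\<^bsub>C\<^esub> Snd C (One C) A) \<odot>\<^bsub>C\<^esub> \<langle>Bang C (KO K A), Idn C (KO K A)\<rangle>\<^bsub>C\<^esub>"

definition smonad_of :: "('o, 'm, 'l) cart \<Rightarrow> ('o, 'm) ktriple \<Rightarrow> ('o, 'm) smonad" where
  "smonad_of C K = \<lparr>
     TO = KO K,
     TM = (\<lambda>f. ext1 C K (Dom C f) (Cod C f) (KEta K (Cod C f) \<odot>\<^bsub>C\<^esub> f)),
     Eta = KEta K,
     Mu = (\<lambda>A. ext1 C K (KO K A) A (Idn C (KO K A))),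
     Str = (\<lambda>A B. KExt K A B (A \<otimes>\<^bsub>C\<^esub> B) (KEta K (A \<otimes>\<^bsub>C\<^esub> B))) \<rparr>"


section \<open>Models\<close>

definition sem_sig :: "('o, 'm, 'l) cart \<Rightarrow> ('l, 'o \<times> 'o) fmap \<Rightarrow> bool" where
  "sem_sig C S \<longleftrightarrow> fmpred (\<lambda>_ (A, B). A \<in> Obj C \<and> B \<in> Obj C) S"

text \<open>\<open>HFam C Kex S S' X\<close> is the family whose product is \<open>\<H>\<^sub>S\<close> at the computation type \<open>X\<close> over \<open>S'\<close>,
  with function types read as Kleisli exponentials.\<close>

definition HFam :: "('o, 'm, 'l) cart \<Rightarrow> (('l, 'o \<times> 'o) fmap \<Rightarrow> 'o \<Rightarrow> 'o \<Rightarrow> 'o) \<Rightarrow>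
    ('l, 'o \<times> 'o) fmap \<Rightarrow> ('l, 'o \<times> 'o) fmap \<Rightarrow> 'o \<Rightarrow> ('l idx, 'o) fmap" where
  "HFam C Kex S S' X = op_family (fmmap (\<lambda>(A, B). Kex S' (A \<otimes>\<^bsub>C\<^esub> Kex S' B X) X) S)"

locale lam_eff_model = cartesian_category C
  for C :: "('o, 'm, 'l) cart" (structure) +
  fixes Mon :: "('l, 'o \<times> 'o) fmap \<Rightarrow> ('o, 'm) smonad"
    and Kex :: "('l, 'o \<times> 'o) fmap \<Rightarrow> 'o \<Rightarrow> 'o \<Rightarrow> 'o"
    and Kev :: "('l, 'o \<times> 'o) fmap \<Rightarrow> 'o \<Rightarrow> 'o \<Rightarrow> 'm"
    and Opr :: "('l, 'o \<times> 'o) fmap \<Rightarrow> 'l \<Rightarrow> 'm"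
    and Hdl :: "('l, 'o \<times> 'o) fmap \<Rightarrow> ('l, 'o \<times> 'o) fmap \<Rightarrow> 'o \<Rightarrow> 'm"
  assumes monad: "sem_sig C S \<Longrightarrow> strong_monad C (Mon S)"
    and kexp_obj: "sem_sig C S \<Longrightarrow> A \<in> Obj C \<Longrightarrow> B \<in> Obj C \<Longrightarrow> Kex S A B \<in> Obj C"
    and kev_hom: "sem_sig C S \<Longrightarrow> A \<in> Obj C \<Longrightarrow> B \<in> Obj C \<Longrightarrow>
      Kev S A B \<in> Hom C (Kex S A B \<otimes> A) (TO (Mon S) B)"
    and kexp_univ: "sem_sig C S \<Longrightarrow> A \<in> Obj C \<Longrightarrow> B \<in> Obj C \<Longrightarrow> D \<in> Obj C \<Longrightarrow>
      f \<in> Hom C (D \<otimes> A) (TO (Mon S) B) \<Longrightarrow>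
      \<exists>!g. g \<in> Hom C D (Kex S A B) \<and> Kev S A B \<odot> (g \<otimes>\<otimes> Idn C A) = f"
    and op_hom: "sem_sig C S \<Longrightarrow> fmlookup S l = Some (A, B) \<Longrightarrow> Opr S l \<in> Hom C A (TO (Mon S) B)"
    and handle_hom: "sem_sig C S \<Longrightarrow> sem_sig C S' \<Longrightarrow> X \<in> Obj C \<Longrightarrow>
      Hdl S S' X \<in> Hom C (Prd C (HFam C Kex S S' X) \<otimes> TO (Mon S) (TO (Mon S') X)) (TO (Mon S') X)"
    and handle_eta: "sem_sig C S \<Longrightarrow> sem_sig C S' \<Longrightarrow> X \<in> Obj C \<Longrightarrow>
      H = Prd C (HFam C Kex S S' X) \<Longrightarrow>
      Hdl S S' X \<odot> (Idn C H \<otimes>\<otimes> Eta (Mon S) (TO (Mon S') X)) = Snd C H (TO (Mon S') X)"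
    and handle_mu: "sem_sig C S \<Longrightarrow> sem_sig C S' \<Longrightarrow> X \<in> Obj C \<Longrightarrow>
      H = Prd C (HFam C Kex S S' X) \<Longrightarrow> Y = TO (Mon S) (TO (Mon S') X) \<Longrightarrow>
      Hdl S S' X \<odot> (Idn C H \<otimes>\<otimes> Mu (Mon S) (TO (Mon S') X)) =
      Hdl S S' X \<odot> (Idn C H \<otimes>\<otimes> TM (Mon S) (Hdl S S' X)) \<odot>
        \<langle>Fst C H (TO (Mon S) Y), Str (Mon S) H Y\<rangle>"
    and handle_op: "sem_sig C S \<Longrightarrow> sem_sig C S' \<Longrightarrow> X \<in> Obj C \<Longrightarrow>
      fmlookup S l = Some (A, B) \<Longrightarrow>
      H = Prd C (HFam C Kex S S' X) \<Longrightarrow> E = Kex S' B X \<Longrightarrow>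
      a = TM (Mon S) (Kev S' B X) \<odot> Str (Mon S) E B \<odot> Swap C (TO (Mon S) B) E \<odot>
        (Opr S l \<otimes>\<otimes> Idn C E) \<Longrightarrow>
      Hdl S S' X \<odot> (Idn C H \<otimes>\<otimes> a) =
      Kev S' (A \<otimes> E) X \<odot> (Prj C (HFam C Kex S S' X) (Lab l) \<otimes>\<otimes> Idn C (A \<otimes> E))"


section \<open>The term category and its structure\<close>

text \<open>An arrow \<open>A \<rightarrow> B\<close> is a triple of \<open>A\<close>, \<open>B\<close> and a provable-equality class of values
  \<open>x : A \<turnstile> V : B\<close>, where \<open>x\<close> is index 0. Operations on arrows take the union over all
  representatives of the class of the result.\<close>

type_synonym 'l tarr = "'l ty \<times> 'l ty \<times> 'l val set"

definition cls :: "'l ty \<Rightarrow> 'l ty \<Rightarrow> 'l val \<Rightarrow> 'l val set" where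
  "cls A B V = {W. [A] \<turnstile>\<^sub>v V \<approx> W : B}"

definition arr :: "'l ty \<Rightarrow> 'l ty \<Rightarrow> 'l val \<Rightarrow> 'l tarr" where
  "arr A B V = (A, B, cls A B V)"

text \<open>Substitution for the only free variable of \<open>V\<close>; the result may live in any context.\<close>

definition subst1 :: "'l val \<Rightarrow> 'l val \<Rightarrow> 'l val" where
  "subst1 V W = sub_val V (\<lambda>_. W)"

definition term_comp :: "'l tarr \<Rightarrow> 'l tarr \<Rightarrow> 'l tarr" where
  "term_comp = (\<lambda>(_, D, d) (A, _, c). (A, D, \<Union>W\<in>d. \<Union>V\<in>c. cls A D (subst1 W V)))"

definition term_tuple :: "'l ty \<Rightarrow> ('l idx, 'l tarr) fmap \<Rightarrow> 'l tarr" where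
  "term_tuple A fs = (let P = TProd (fmmap (\<lambda>(_, B, _). B) fs) in
     (A, P, \<Union>Vs\<in>{Vs. fmrel (\<lambda>V (_, _, c). V \<in> c) Vs fs}. cls A P (VTup Vs)))"

definition term_cat :: "('l ty, 'l tarr, 'l) cart" where
  "term_cat = \<lparr>
     Obj = UNIV,
     Arr = {arr A B V | A B V. [A] \<turnstile>\<^sub>v V : B},
     Dom = (\<lambda>(A, _, _). A),
     Cod = (\<lambda>(_, B, _). B),
     Idn = (\<lambda>A. arr A A (VVar 0)),
     Cmp = term_comp,
     Prd = TProd,
     Prj = (\<lambda>As i. arr (TProd As) (the (fmlookup As i)) (VPrj i (VVar 0))),
     Tpl = term_tuple \<rparr>"

definition TT :: "'l sig \<Rightarrow> 'l ty \<Rightarrow> 'l ty" where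
  "TT S A = TFun TUnit (CTy A S)"

text \<open>For \<open>x : A\<^sub>1 \<times> A\<^sub>2 \<turnstile> V : unit \<rightarrow> B!S\<close>. Below the binder \<open>y\<close>, index 1 is \<open>x'\<close>; in the body of
  the let, index 0 is \<open>x\<^sub>2\<close> and index 2 is \<open>x'\<close>.\<close>

definition ext_term :: "'l val \<Rightarrow> 'l val" where
  "ext_term V = VLam (CLet (CApp (VSnd (VVar 1)) VUnit)
     (CApp (subst1 V (VPair (VFst (VVar 2)) (VVar 0))) VUnit))"

definition term_triple :: "'l sig \<Rightarrow> ('l ty, 'l tarr) ktriple" where
  "term_triple S = \<lparr>
     KO = TT S,
     KEta = (\<lambda>A. arr A (TT S A) (VLam (CRet (VVar 1)))),
     KExt = (\<lambda>A1 A2 B (_, _, c).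
       (TPair A1 (TT S A2), TT S B, \<Union>V\<in>c. cls (TPair A1 (TT S A2)) (TT S B) (ext_term V))) \<rparr>"

definition term_kexp :: "'l sig \<Rightarrow> 'l ty \<Rightarrow> 'l ty \<Rightarrow> 'l ty" where
  "term_kexp S A B = TFun A (CTy B S)"

definition term_kev :: "'l sig \<Rightarrow> 'l ty \<Rightarrow> 'l ty \<Rightarrow> 'l tarr" where
  "term_kev S A B = arr (TPair (term_kexp S A B) A) (TT S B)
     (VLam (CApp (VFst (VVar 1)) (VSnd (VVar 1))))"

definition term_op :: "'l sig \<Rightarrow> 'l \<Rightarrow> 'l tarr" where
  "term_op S l = (case the (fmlookup S l) of (A, B) \<Rightarrow> arr A (TT S B) (VLam (COp l (VVar 1))))"

definition HTy :: "'l sig \<Rightarrow> 'l cty \<Rightarrow> 'l ty" where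
  "HTy S X = TProd (op_family (fmmap (\<lambda>(A, B). TFun (TPair A (TFun B X)) X) S))"

text \<open>In an operation clause, index 0 is \<open>k\<close>, 1 is \<open>y\<close>, 2 is \<open>z\<close> and 3 is \<open>x\<close>.\<close>

definition term_handler :: "'l sig \<Rightarrow> ('l, 'l comp) fmap" where
  "term_handler S =
     fmmap_keys (\<lambda>l _. CApp (VPrj (Lab l) (VFst (VVar 3))) (VPair (VVar 1) (VVar 0))) S"

definition term_handle :: "'l sig \<Rightarrow> 'l sig \<Rightarrow> 'l ty \<Rightarrow> 'l tarr" where
  "term_handle S S' A = arr (TPair (HTy S (CTy A S')) (TT S (TT S' A))) (TT S' A)
     (VLam (CHandle (CApp (VSnd (VVar 1)) VUnit) (term_handler S) (CApp (VVar 0) VUnit)))"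

end

theory Submission
  imports Defs
begin

text \<open>
  All laws except the \<open>\<eta>\<close>-laws for functions and products and \<open>let x \<Leftarrow> M in return x = M\<close>, read from
  left to right, form an untyped reduction with subject reduction, so a reduction step from a typed
  term is a provable equation without further typing conditions. Two arrows into \<open>unit \<rightarrow> B!S\<close> agree
  as soon as the computations obtained by applying them to \<open>\<langle>\<rangle>\<close> agree (\<open>\<eta>\<close> for functions and for the
  empty product). Every law of a model thus becomes a comparison of two reducts; where these differ at
  all, they differ by one of the excluded laws.
\<close>

section \<open>Substitution and typing\<close>

text \<open>The reducts must be computed around unknown parts: an arrow is an arbitrary class of
  terms and a signature an arbitrary finite map. Two shapes make this possible. An arbitrary arrow
  is carried as \<open>sub_val F (\<lambda>_. W)\<close>, and the clauses of the interpreted handler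
  as \<open>hterm S V\<close>; substitution and renaming then act on \<open>W\<close> and
  \<open>V\<close> alone, so simplification brings both sides of a law to comparable form. The laws
  of the strong monad are not transferred from the Kleisli triple by an abstract argument:
  functorial action, multiplication and strength are themselves computed to terms, and their laws
  are compared like all others. Apart from the passage to thunks, the excluded laws enter at few
  places: product eta where a tuple is rebuilt from its projections, the right unit law of let where
  a result is merely returned again, and function eta for the uniqueness of curried arrows and for
  the continuation handed to an operation clause.\<close>

lemma up_ren_simps [simp]:
  "up_ren r 0 = 0" "up_ren r (Suc n) = Suc (r n)"
  by (simp_all add: up_ren_def)

lemma up_sub_simps [simp]:
  "up_sub s 0 = VVar 0" "up_sub s (Suc n) = ren_val (s n) Suc"
  by (simp_all add: up_sub_def)

lemma up_ren_comp: "(\<lambda>n. up_ren r (up_ren q n)) = up_ren (\<lambda>n. r (q n))"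
  by (rule ext) (simp add: up_ren_def split: nat.split)

lemma up_sub_up_ren: "(\<lambda>n. up_sub s (up_ren r n)) = up_sub (\<lambda>n. s (r n))"
  by (rule ext) (simp add: up_ren_def up_sub_def split: nat.split)

text \<open>First of four fusion laws whose order is forced by the binders:
  \<open>ren_up_sub\<close> needs \<open>ren_ren\<close>, and \<open>sub_up_sub\<close> needs both
  \<open>sub_ren\<close> and \<open>ren_sub\<close>. As simp rules they collapse any stack of
  renamings and substitutions on an unknown term into a single one.\<close>

lemma ren_ren [simp]:
  fixes V :: "'l val" and M :: "'l comp"
  shows "ren_val (ren_val V q) r = ren_val V (\<lambda>n. r (q n))"
    and "ren_comp (ren_comp M q) r = ren_comp M (\<lambda>n. r (q n))"
  by (induction V and M arbitrary: q r and q r rule: val.induct comp.induct)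
    (auto simp: fmap.map_comp o_def up_ren_comp intro!: fmap.map_cong0)

lemma sub_ren [simp]:
  fixes V :: "'l val" and M :: "'l comp"
  shows "sub_val (ren_val V r) s = sub_val V (\<lambda>n. s (r n))"
    and "sub_comp (ren_comp M r) s = sub_comp M (\<lambda>n. s (r n))"
  by (induction V and M arbitrary: s r and s r rule: val.induct comp.induct)
    (auto simp: fmap.map_comp o_def up_sub_up_ren intro!: fmap.map_cong0)

lemma ren_up_sub: "(\<lambda>n. ren_val (up_sub s n) (up_ren r)) = up_sub (\<lambda>n. ren_val (s n) r)"
  by (rule ext) (simp add: up_sub_def split: nat.split)

lemma ren_sub [simp]:
  fixes V :: "'l val" and M :: "'l comp"
  shows "ren_val (sub_val V s) r = sub_val V (\<lambda>n. ren_val (s n) r)"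
    and "ren_comp (sub_comp M s) r = sub_comp M (\<lambda>n. ren_val (s n) r)"
  by (induction V and M arbitrary: s r and s r rule: val.induct comp.induct)
    (auto simp: fmap.map_comp o_def ren_up_sub intro!: fmap.map_cong0)

lemma sub_up_sub: "(\<lambda>n. sub_val (up_sub s n) (up_sub t)) = up_sub (\<lambda>n. sub_val (s n) t)"
  by (rule ext) (simp add: up_sub_def split: nat.split)

lemma sub_sub [simp]:
  fixes V :: "'l val" and M :: "'l comp"
  shows "sub_val (sub_val V s) t = sub_val V (\<lambda>n. sub_val (s n) t)"
    and "sub_comp (sub_comp M s) t = sub_comp M (\<lambda>n. sub_val (s n) t)"
  by (induction V and M arbitrary: s t and s t rule: val.induct comp.induct)
    (auto simp: fmap.map_comp o_def sub_up_sub intro!: fmap.map_cong0)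

lemma up_sub_up_var: "up_sub (\<lambda>n. VVar (r n)) = (\<lambda>n. VVar (up_ren r n))"
  by (rule ext) (simp add: up_sub_def up_ren_def split: nat.split)

text \<open>Transfers results on substitution to renaming, for equations and reductions. For typing
  the dependency is reversed: lifting a typed substitution in \<open>sub_ty_up\<close> already uses
  typed renaming.\<close>

lemma ren_eq_sub:
  fixes V :: "'l val" and M :: "'l comp"
  shows "ren_val V r = sub_val V (\<lambda>n. VVar (r n))"
    and "ren_comp M r = sub_comp M (\<lambda>n. VVar (r n))"
  by (induction V and M arbitrary: r and r rule: val.induct comp.induct)
    (auto simp: up_sub_up_var intro!: fmap.map_cong0)

lemma up_ren_id: "up_ren (\<lambda>n. n) = (\<lambda>n. n)"
  by (rule ext) (simp add: up_ren_def split: nat.split)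

lemma ren_id [simp]:
  fixes V :: "'l val" and M :: "'l comp"
  shows "ren_val V (\<lambda>n. n) = V"
    and "ren_comp M (\<lambda>n. n) = M"
  by (induction V and M rule: val.induct comp.induct)
    (auto simp: up_ren_id fmap.map_ident cong: fmap.map_cong)

lemma sub_var [simp]:
  fixes V :: "'l val" and M :: "'l comp"
  shows "sub_val V VVar = V" "sub_comp M VVar = M"
  using ren_eq_sub(1)[of V "\<lambda>n. n"] ren_eq_sub(2)[of M "\<lambda>n. n"] by simp_all

section \<open>Typing under renaming and substitution\<close>

definition ren_ty :: "(nat \<Rightarrow> nat) \<Rightarrow> 'l ty list \<Rightarrow> 'l ty list \<Rightarrow> bool" where
  "ren_ty r \<Gamma> \<Delta> \<longleftrightarrow> (\<forall>n<length \<Gamma>. r n < length \<Delta> \<and> \<Delta> ! r n = \<Gamma> ! n)"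

text \<open>Only the indices below \<open>length \<Gamma>\<close> are constrained, so the constant
  substitution \<open>\<lambda>_. V\<close> is well typed from a one-variable context.\<close>

definition sub_ty :: "(nat \<Rightarrow> 'l val) \<Rightarrow> 'l ty list \<Rightarrow> 'l ty list \<Rightarrow> bool" where
  "sub_ty s \<Gamma> \<Delta> \<longleftrightarrow> (\<forall>n<length \<Gamma>. \<Delta> \<turnstile>\<^sub>v s n : \<Gamma> ! n)"

lemma ren_ty_up: "ren_ty r \<Gamma> \<Delta> \<Longrightarrow> ren_ty (up_ren r) (A # \<Gamma>) (A # \<Delta>)"
  by (auto simp: ren_ty_def up_ren_def nth_Cons split: nat.split)

lemma ren_ty_Suc: "ren_ty Suc \<Gamma> (A # \<Gamma>)"
  by (auto simp: ren_ty_def)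

lemma ty_var': "n < length \<Gamma> \<Longrightarrow> \<Gamma> ! n = A \<Longrightarrow> \<Gamma> \<turnstile>\<^sub>v VVar n : A"
  using ty_var by blast

lemma ty_ren:
  "\<Gamma> \<turnstile>\<^sub>v V : A \<Longrightarrow> ren_ty r \<Gamma> \<Delta> \<Longrightarrow> \<Delta> \<turnstile>\<^sub>v ren_val V r : A"
  "\<Gamma> \<turnstile>\<^sub>c M : C \<Longrightarrow> ren_ty r \<Gamma> \<Delta> \<Longrightarrow> \<Delta> \<turnstile>\<^sub>c ren_comp M r : C"
proof (induction arbitrary: r \<Delta> and r \<Delta> rule: has_vty_has_cty.inducts)
  case (ty_var n \<Gamma>)
  then show ?case by (auto simp: ren_ty_def intro: ty_var')
next
  case (ty_handle \<Gamma> M A S H C N)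
  show ?case unfolding ren_comp.simps
    by (rule has_vty_has_cty.ty_handle[where S=S and A=A])
      (use ty_handle in \<open>auto simp: ren_ty_up\<close>)
next
  case (ty_tup Vs As \<Gamma>)
  then show ?case by (auto intro!: has_vty_has_cty.ty_tup)
next
  case (ty_app \<Gamma> V A C W)
  then show ?case by (auto intro!: has_vty_has_cty.ty_app)
next
  case (ty_let \<Gamma> M A S N B)
  then show ?case by (auto intro!: has_vty_has_cty.ty_let simp: ren_ty_up)
qed (auto simp: ren_ty_up intro: ty_lam ty_prj ty_ret ty_op)

lemma sub_ty_up: "sub_ty s \<Gamma> \<Delta> \<Longrightarrow> sub_ty (up_sub s) (A # \<Gamma>) (A # \<Delta>)"
  by (auto simp: sub_ty_def up_sub_def nth_Cons split: nat.split intro: ty_var' ty_ren ren_ty_Suc)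

lemma ty_sub:
  "\<Gamma> \<turnstile>\<^sub>v V : A \<Longrightarrow> sub_ty s \<Gamma> \<Delta> \<Longrightarrow> \<Delta> \<turnstile>\<^sub>v sub_val V s : A"
  "\<Gamma> \<turnstile>\<^sub>c M : C \<Longrightarrow> sub_ty s \<Gamma> \<Delta> \<Longrightarrow> \<Delta> \<turnstile>\<^sub>c sub_comp M s : C"
proof (induction arbitrary: s \<Delta> and s \<Delta> rule: has_vty_has_cty.inducts)
  case (ty_var n \<Gamma>)
  then show ?case by (auto simp: sub_ty_def)
next
  case (ty_handle \<Gamma> M A S H C N)
  show ?case unfolding sub_comp.simps
    by (rule has_vty_has_cty.ty_handle[where S=S and A=A])
      (use ty_handle in \<open>auto simp: sub_ty_up\<close>)
next
  case (ty_tup Vs As \<Gamma>)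
  then show ?case by (auto intro!: has_vty_has_cty.ty_tup)
next
  case (ty_app \<Gamma> V A C W)
  then show ?case by (auto intro!: has_vty_has_cty.ty_app)
next
  case (ty_let \<Gamma> M A S N B)
  then show ?case by (auto intro!: has_vty_has_cty.ty_let simp: sub_ty_up)
qed (auto simp: sub_ty_up intro: ty_lam ty_prj ty_ret ty_op)

lemmas ty_sub_up = ty_sub[OF _ sub_ty_up] ty_sub[OF _ sub_ty_up[OF sub_ty_up]]

text \<open>The handler laws have the typing of all clauses as a premise; this supplies that premise
  for the substituted clause map. \<open>ty_clause_wk\<close> does the same for the weakened clauses
  that \<open>handle_let\<close> places under a binder.\<close>

lemma ty_clause_sub:
  assumes "\<And>l A' B' P. fmlookup S l = Some (A', B') \<Longrightarrow> fmlookup H l = Some P \<Longrightarrow> TFun B' C # A' # \<Gamma> \<turnstile>\<^sub>c P : C"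
    and "sub_ty s \<Gamma> \<Delta>" and "fmlookup S l = Some (A', B')"
    and "fmlookup (fmmap (\<lambda>P. sub_comp P (up_sub (up_sub s))) H) l = Some P"
  shows "TFun B' C # A' # \<Delta> \<turnstile>\<^sub>c P : C"
proof -
  from assms(4) obtain Q where Q: "fmlookup H l = Some Q" "P = sub_comp Q (up_sub (up_sub s))" by auto
  show ?thesis unfolding Q(2) by (rule ty_sub_up(4)[OF assms(1)]) (use assms Q in auto)
qed

lemma ty_clause_wk:
  assumes "\<And>l A' B' P. fmlookup S l = Some (A', B') \<Longrightarrow> fmlookup H l = Some P \<Longrightarrow> TFun B' C # A' # \<Gamma> \<turnstile>\<^sub>c P : C"
    and "fmlookup S l = Some (A', B')" and "fmlookup (wk_handler H) l = Some P"
  shows "TFun B' C # A' # A # \<Gamma> \<turnstile>\<^sub>c P : C"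
proof -
  from assms(3) obtain Q where Q: "fmlookup H l = Some Q" "P = ren_comp Q (up_ren (up_ren Suc))" by auto
  show ?thesis unfolding Q(2)
    by (rule ty_ren(2)[OF assms(1)]) (use assms Q in \<open>auto intro: ren_ty_up ren_ty_Suc\<close>)
qed

lemma sub_ty_inst: "\<Gamma> \<turnstile>\<^sub>v V : A \<Longrightarrow> sub_ty (case_nat V VVar) (A # \<Gamma>) \<Gamma>"
  by (auto simp: sub_ty_def nth_Cons split: nat.split intro: ty_var')

lemma ty_inst: "A # \<Gamma> \<turnstile>\<^sub>c M : C \<Longrightarrow> \<Gamma> \<turnstile>\<^sub>v V : A \<Longrightarrow> \<Gamma> \<turnstile>\<^sub>c inst M V : C"
  unfolding inst_def by (rule ty_sub) (auto intro: sub_ty_inst)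

lemma ty_inst2: "B # A # \<Gamma> \<turnstile>\<^sub>c M : C \<Longrightarrow> \<Gamma> \<turnstile>\<^sub>v V : A \<Longrightarrow> \<Gamma> \<turnstile>\<^sub>v W : B \<Longrightarrow> \<Gamma> \<turnstile>\<^sub>c inst2 M V W : C"
  unfolding inst2_def
  by (rule ty_sub) (auto simp: sub_ty_def nth_Cons split: nat.split intro: ty_var')

section \<open>Inversion of typing, and typedness of provable equations\<close>

inductive_cases vty_lamE: "\<Gamma> \<turnstile>\<^sub>v VLam M : A"
inductive_cases vty_tupE: "\<Gamma> \<turnstile>\<^sub>v VTup Vs : A"
inductive_cases vty_prjE: "\<Gamma> \<turnstile>\<^sub>v VPrj i V : A"
inductive_cases cty_appE: "\<Gamma> \<turnstile>\<^sub>c CApp V W : C"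
inductive_cases cty_retE: "\<Gamma> \<turnstile>\<^sub>c CRet V : C"
inductive_cases cty_letE: "\<Gamma> \<turnstile>\<^sub>c CLet M N : C"
inductive_cases cty_opE: "\<Gamma> \<turnstile>\<^sub>c COp l V : C"
inductive_cases cty_handleE: "\<Gamma> \<turnstile>\<^sub>c CHandle M H N : C"

lemma fmlookup_dom_eq:
  "fmdom m = fmdom n \<Longrightarrow> fmlookup n i = Some y \<Longrightarrow> \<exists>x. fmlookup m i = Some x"
  by (metis fmdomE fmdomI)

lemma ty_wk: "\<Gamma> \<turnstile>\<^sub>v V : A \<Longrightarrow> B # \<Gamma> \<turnstile>\<^sub>v wk_val V : A"
  by (rule ty_ren) (auto intro: ren_ty_Suc)

text \<open>The congruence rules for tuples and handlers speak only of entries present in both maps;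
  equality of the domains provides the missing partner of each entry, and with it the typing of each
  side.\<close>

lemma eq_typed:
  "\<Gamma> \<turnstile>\<^sub>v V \<approx> W : A \<Longrightarrow> \<Gamma> \<turnstile>\<^sub>v V : A \<and> \<Gamma> \<turnstile>\<^sub>v W : A"
  "\<Gamma> \<turnstile>\<^sub>c M \<approx> N : C \<Longrightarrow> \<Gamma> \<turnstile>\<^sub>c M : C \<and> \<Gamma> \<turnstile>\<^sub>c N : C"
proof (induction rule: veq_ceq.inducts)
  case (cong_tup Vs As Vs' \<Gamma>)
  then show ?case by (auto intro!: ty_tup) (metis fmlookup_dom_eq)+
next
  case (cong_handle \<Gamma> M M' A S H H' C N N')
  have "TFun B' C # A' # \<Gamma> \<turnstile>\<^sub>c P : C" if "fmlookup S l = Some (A', B')" "fmlookup H l = Some P" for l A' B' P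
    using that cong_handle by (metis fmlookup_dom_eq)
  moreover have "TFun B' C # A' # \<Gamma> \<turnstile>\<^sub>c P : C" if "fmlookup S l = Some (A', B')" "fmlookup H' l = Some P" for l A' B' P
    using that cong_handle by (metis fmlookup_dom_eq)
  ultimately show ?case using cong_handle by (auto intro!: ty_handle[where S=S and A=A])
next
  case (beta_prod \<Gamma> Vs As i V A)
  then show ?case by (auto intro: ty_prj elim: vty_tupE)
next
  case (eta_prod \<Gamma> V As)
  then show ?case by (auto intro!: ty_tup intro: ty_prj)
next
  case (let_assoc \<Gamma> L A S M B N D)
  have "B # A # \<Gamma> \<turnstile>\<^sub>c wk_comp1 N : CTy D S"
    using let_assoc by (auto intro: ty_ren ren_ty_up ren_ty_Suc)
  then show ?case using let_assoc by (auto intro: ty_let)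
next
  case (handle_ret \<Gamma> V A H S C N)
  then show ?case by (auto intro!: ty_handle[where S=S and A=A] intro: ty_ret ty_inst)
next
  case (handle_let \<Gamma> L A S M B H C N)
  have "A # \<Gamma> \<turnstile>\<^sub>c CHandle M (wk_handler H) (wk_comp1 N) : C"
    by (rule ty_handle[where S=S and A=B, OF _ _ ty_clause_wk[OF handle_let(4)]])
      (use handle_let in \<open>auto intro: ty_ren ren_ty_up ren_ty_Suc\<close>)
  moreover have "\<Gamma> \<turnstile>\<^sub>c CHandle (CLet L M) H N : C"
    by (rule ty_handle[where S=S and A=B]) (use handle_let in \<open>auto intro: ty_let\<close>)
  ultimately show ?case using handle_let by (auto intro!: ty_handle[where S=S and A=A])
next
  case (handle_op S l A B \<Gamma> V H C N P)
  have "\<Gamma> \<turnstile>\<^sub>c CHandle (COp l V) H N : C"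
    by (rule ty_handle[where S=S and A=B]) (use handle_op in \<open>auto intro: ty_op\<close>)
  moreover have "\<Gamma> \<turnstile>\<^sub>c inst2 P V (VLam N) : C"
    by (rule ty_inst2[OF handle_op(4)]) (use handle_op in \<open>auto intro: ty_lam\<close>)
  ultimately show ?case ..
next
  case (eta_fun \<Gamma> V A C)
  then show ?case by (auto intro!: ty_lam ty_app[OF ty_wk ty_var'])
next
  case (let_eta \<Gamma> M A S)
  then show ?case by (auto intro!: ty_let[OF _ ty_ret[OF ty_var']])
qed (auto intro: ty_lam ty_prj ty_app ty_ret ty_let ty_op ty_inst)

section \<open>Stability of provable equality under substitution\<close>

lemma sub_inst: "sub_comp (inst M V) s = inst (sub_comp M (up_sub s)) (sub_val V s)"
  unfolding inst_def by (simp, rule arg_cong[where f="sub_comp M"]) (auto simp: fun_eq_iff split: nat.split)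

lemma sub_inst2: "sub_comp (inst2 M V W) s =
  inst2 (sub_comp M (up_sub (up_sub s))) (sub_val V s) (sub_val W s)"
  unfolding inst2_def by (simp, rule arg_cong[where f="sub_comp M"]) (auto simp: fun_eq_iff split: nat.split)

lemma sub_wk_comp1: "sub_comp (wk_comp1 N) (up_sub (up_sub s)) = wk_comp1 (sub_comp N (up_sub s))"
  by (simp, rule arg_cong[where f="sub_comp N"]) (auto simp: fun_eq_iff up_sub_def split: nat.split)

lemma sub_wk_comp2:
  "sub_comp (ren_comp P (up_ren (up_ren Suc))) (up_sub (up_sub (up_sub s))) =
   ren_comp (sub_comp P (up_sub (up_sub s))) (up_ren (up_ren Suc))"
  by (simp, rule arg_cong[where f="sub_comp P"]) (auto simp: fun_eq_iff up_sub_def split: nat.split)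

text \<open>Each law is a scheme closed under substitution: by \<open>sub_inst\<close>,
  \<open>sub_inst2\<close> and the two weakening lemmas, substituting into both sides of an instance
  yields another instance of the same law.\<close>

lemma eq_sub:
  "\<Gamma> \<turnstile>\<^sub>v V \<approx> W : A \<Longrightarrow> sub_ty s \<Gamma> \<Delta> \<Longrightarrow> \<Delta> \<turnstile>\<^sub>v sub_val V s \<approx> sub_val W s : A"
  "\<Gamma> \<turnstile>\<^sub>c M \<approx> N : C \<Longrightarrow> sub_ty s \<Gamma> \<Delta> \<Longrightarrow> \<Delta> \<turnstile>\<^sub>c sub_comp M s \<approx> sub_comp N s : C"
proof (induction arbitrary: s \<Delta> and s \<Delta> rule: veq_ceq.inducts)
  case (cong_handle \<Gamma> M M' A S H H' C N N')
  show ?case unfolding sub_comp.simps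
    by (rule veq_ceq.cong_handle[where S=S and A=A]) (use cong_handle in \<open>auto simp: sub_ty_up\<close>)
next
  case (beta_fun A \<Gamma> M C V)
  then show ?case by (auto simp: sub_inst intro: veq_ceq.beta_fun ty_sub sub_ty_up)
next
  case (eta_fun \<Gamma> V A C)
  then have "\<Delta> \<turnstile>\<^sub>v sub_val V s : TFun A C" by (auto intro: ty_sub)
  from veq_ceq.eta_fun[OF this] show ?case by simp
next
  case (eta_prod \<Gamma> V As)
  then have "\<Delta> \<turnstile>\<^sub>v sub_val V s : TProd As" by (auto intro: ty_sub)
  from veq_ceq.eta_prod[OF this]
  have *: "\<Delta> \<turnstile>\<^sub>v sub_val V s \<approx> VTup (fmmap_keys (\<lambda>i _. VPrj i (sub_val V s)) As) : TProd As" .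
  \<comment> \<open>The eta-expansion takes its set of components from the type \<open>As\<close>,
    so substitution changes only the value that is projected.\<close>
  have "fmmap (\<lambda>V. sub_val V s) (fmmap_keys (\<lambda>i _. VPrj i V) As) = fmmap_keys (\<lambda>i _. VPrj i (sub_val V s)) As"
    by (rule fmap_ext) (simp add: option.map_comp o_def)
  with * show ?case by simp
next
  case (beta_prod \<Gamma> Vs As i V A)
  have "\<Delta> \<turnstile>\<^sub>v sub_val (VTup Vs) s : TProd As" using beta_prod by (blast intro: ty_sub)
  then show ?case using beta_prod by (auto intro!: veq_ceq.beta_prod)
next
  case (let_ret \<Gamma> V A N B S)
  then show ?case by (auto simp: sub_inst intro: veq_ceq.let_ret ty_sub sub_ty_up)
next
  case (let_eta \<Gamma> M A S)
  then show ?case by (auto intro: veq_ceq.let_eta ty_sub sub_ty_up)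
next
  case (let_assoc \<Gamma> L A S M B N D)
  have "\<Delta> \<turnstile>\<^sub>c CLet (CLet (sub_comp L s) (sub_comp M (up_sub s))) (sub_comp N (up_sub s)) \<approx>
    CLet (sub_comp L s) (CLet (sub_comp M (up_sub s)) (wk_comp1 (sub_comp N (up_sub s)))) : CTy D S"
    using let_assoc by (blast intro: veq_ceq.let_assoc ty_sub ty_sub_up)
  then show ?case by (simp only: sub_comp.simps sub_wk_comp1)
next
  case (handle_ret \<Gamma> V A H S C N)
  show ?case unfolding sub_comp.simps sub_inst
    by (rule veq_ceq.handle_ret[where S=S and A=A, OF _ _ ty_clause_sub[OF handle_ret(3)]])
      (use handle_ret in \<open>auto intro: ty_sub ty_sub_up\<close>)
next
  case (handle_let \<Gamma> L A S M B H C N)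
  have "\<Delta> \<turnstile>\<^sub>c CHandle (CLet (sub_comp L s) (sub_comp M (up_sub s))) (fmmap (\<lambda>P. sub_comp P (up_sub (up_sub s))) H) (sub_comp N (up_sub s)) \<approx>
    CHandle (sub_comp L s) (fmmap (\<lambda>P. sub_comp P (up_sub (up_sub s))) H) (CHandle (sub_comp M (up_sub s)) 
     (wk_handler (fmmap (\<lambda>P. sub_comp P (up_sub (up_sub s))) H)) (wk_comp1 (sub_comp N (up_sub s)))) : C"
    by (rule veq_ceq.handle_let[where S=S and A=A, OF _ _ _ ty_clause_sub[OF handle_let(4)]])
      (use handle_let in \<open>auto intro: ty_sub ty_sub_up\<close>)
  then show ?case by (simp only: sub_comp.simps sub_wk_comp1 fmap.map_comp o_def sub_wk_comp2)
next
  case (handle_op S l A B \<Gamma> V H C N P)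
  show ?case unfolding sub_comp.simps sub_inst2 sub_val.simps
    by (rule veq_ceq.handle_op[where S=S and A=A, OF _ _ _ ty_clause_sub[OF handle_op(4)]])
      (use handle_op in \<open>auto intro: ty_sub ty_sub_up\<close>)
next
  case (veq_sym \<Gamma> V W A) then show ?case by (blast intro: veq_ceq.veq_sym)
next
  case (ceq_sym \<Gamma> V W A) then show ?case by (blast intro: veq_ceq.ceq_sym)
next
  case (veq_trans \<Gamma> U V W A) then show ?case by (blast intro: veq_ceq.veq_trans)
next
  case (ceq_trans \<Gamma> U V W A) then show ?case by (blast intro: veq_ceq.ceq_trans)
next
  case (cong_tup Vs As Vs' \<Gamma>)
  then show ?case by (auto intro!: veq_ceq.cong_tup)
next
  case (cong_app \<Gamma> V V' A C W W')
  then show ?case by (auto intro!: veq_ceq.cong_app)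
next
  case (cong_let \<Gamma> M M' A S N N' B)
  then show ?case by (auto intro!: veq_ceq.cong_let simp: sub_ty_up)
qed (auto simp: sub_ty_up intro: veq_refl ceq_refl cong_lam cong_prj cong_ret cong_op ty_sub)

lemma eq_wk: "\<Gamma> \<turnstile>\<^sub>v V \<approx> W : A \<Longrightarrow> B # \<Gamma> \<turnstile>\<^sub>v wk_val V \<approx> wk_val W : A"
  unfolding ren_eq_sub by (rule eq_sub) (auto simp: sub_ty_def intro: ty_var')

definition sub_eq :: "(nat \<Rightarrow> 'l val) \<Rightarrow> (nat \<Rightarrow> 'l val) \<Rightarrow> 'l ty list \<Rightarrow> 'l ty list \<Rightarrow> bool" where
  "sub_eq s t \<Gamma> \<Delta> \<longleftrightarrow> (\<forall>n<length \<Gamma>. \<Delta> \<turnstile>\<^sub>v s n \<approx> t n : \<Gamma> ! n)"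

lemma sub_eq_up: "sub_eq s t \<Gamma> \<Delta> \<Longrightarrow> sub_eq (up_sub s) (up_sub t) (A # \<Gamma>) (A # \<Delta>)"
  by (auto simp: sub_eq_def up_sub_def nth_Cons split: nat.split intro: eq_wk intro!: veq_refl[OF ty_var'])

text \<open>Counterpart of \<open>eq_sub\<close>: the term stays fixed and the substituted values
  vary. Induction is on typing because the congruence rules carry types.\<close>

lemma sub_cong:
  "\<Gamma> \<turnstile>\<^sub>v V : A \<Longrightarrow> sub_eq s t \<Gamma> \<Delta> \<Longrightarrow> \<Delta> \<turnstile>\<^sub>v sub_val V s \<approx> sub_val V t : A"
  "\<Gamma> \<turnstile>\<^sub>c M : C \<Longrightarrow> sub_eq s t \<Gamma> \<Delta> \<Longrightarrow> \<Delta> \<turnstile>\<^sub>c sub_comp M s \<approx> sub_comp M t : C"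
proof (induction arbitrary: s t \<Delta> and s t \<Delta> rule: has_vty_has_cty.inducts)
  case (ty_var n \<Gamma>)
  then show ?case by (auto simp: sub_eq_def)
next
  case (ty_handle \<Gamma> M A S H C N)
  show ?case unfolding sub_comp.simps
    by (rule veq_ceq.cong_handle[where S=S and A=A])
      (use ty_handle in \<open>auto simp: sub_eq_up\<close>)
next
  case (ty_tup Vs As \<Gamma>)
  then show ?case by (auto intro!: cong_tup)
next
  case (ty_app \<Gamma> V A C W)
  then show ?case by (auto intro!: cong_app)
next
  case (ty_let \<Gamma> M A S N B)
  then show ?case by (auto intro!: cong_let simp: sub_eq_up)
qed (auto simp: sub_eq_up intro: cong_lam cong_prj cong_ret cong_op)

text \<open>A typed term sees only the variables of its context. For a one-variable context this
  allows every representative to be written with a constant substitution.\<close>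

lemma sub_typed_cong:
  "\<Gamma> \<turnstile>\<^sub>v V : A \<Longrightarrow> (\<And>n. n < length \<Gamma> \<Longrightarrow> s n = t n) \<Longrightarrow> sub_val V s = sub_val V t"
  "\<Gamma> \<turnstile>\<^sub>c M : C \<Longrightarrow> (\<And>n. n < length \<Gamma> \<Longrightarrow> s n = t n) \<Longrightarrow> sub_comp M s = sub_comp M t"
proof (induction arbitrary: s t and s t rule: has_vty_has_cty.inducts)
  case (ty_tup Vs As \<Gamma>)
  have "sub_val V s = sub_val V t" if "V \<in> fmran' Vs" for V
  proof -
    from that obtain i where i: "fmlookup Vs i = Some V" by (auto simp: fmlookup_ran'_iff)
    then obtain A where A: "fmlookup As i = Some A"
      using ty_tup.hyps by (metis fmlookup_dom_eq)
    show ?thesis by (rule ty_tup.IH[OF i A ty_tup.prems])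
  qed
  then show ?case by (auto intro: fmap.map_cong0)
next
  case (ty_lam A \<Gamma> M C)
  have "up_sub s n = up_sub t n" if "n < Suc (length \<Gamma>)" for n
    using that ty_lam.prems by (cases n) auto
  then show ?case using ty_lam.IH[of "up_sub s" "up_sub t"] by simp
next
  case (ty_let \<Gamma> M A S N B)
  have "up_sub s n = up_sub t n" if "n < Suc (length \<Gamma>)" for n
    using that ty_let.prems by (cases n) auto
  then show ?case using ty_let.IH(2)[of "up_sub s" "up_sub t"] ty_let.IH(1)[of s t] ty_let.prems by simp
next
  case (ty_handle \<Gamma> M A S H C N)
  have up: "up_sub s n = up_sub t n" if "n < Suc (length \<Gamma>)" for n
    using that ty_handle.prems by (cases n) auto
  then have up2: "up_sub (up_sub s) n = up_sub (up_sub t) n" if "n < Suc (Suc (length \<Gamma>))" for n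
    using that by (cases n) auto
  have "sub_comp P (up_sub (up_sub s)) = sub_comp P (up_sub (up_sub t))" if "P \<in> fmran' H" for P
  proof -
    from that obtain l where l: "fmlookup H l = Some P" by (auto simp: fmlookup_ran'_iff)
    then obtain A' B' where "fmlookup S l = Some (A', B')"
      using ty_handle.hyps by (metis fmlookup_dom_eq surj_pair)
    with l ty_handle.IH(2)[of l A' B' P "up_sub (up_sub s)" "up_sub (up_sub t)"] up2 show ?thesis by simp
  qed
  then have "fmmap (\<lambda>P. sub_comp P (up_sub (up_sub s))) H = fmmap (\<lambda>P. sub_comp P (up_sub (up_sub t))) H"
    by (rule fmap.map_cong0)
  moreover have "sub_comp M s = sub_comp M t"
    by (rule ty_handle.IH(1)) (rule ty_handle.prems)
  moreover have "sub_comp N (up_sub s) = sub_comp N (up_sub t)"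
    by (rule ty_handle.IH(3)) (simp add: up)
  ultimately show ?case by simp
next
  case (ty_app \<Gamma> V A C W)
  show ?case using ty_app.IH(1)[of s t] ty_app.IH(2)[of s t] ty_app.prems by simp
next
  case (ty_prj \<Gamma> V As i A)
  show ?case using ty_prj.IH[of s t] ty_prj.prems by simp
next
  case (ty_ret \<Gamma> V A S)
  show ?case using ty_ret.IH[of s t] ty_ret.prems by simp
next
  case (ty_op S l A B \<Gamma> V)
  show ?case using ty_op.IH[of s t] ty_op.prems by simp
qed simp

section \<open>Reduction\<close>

text \<open>Reflexivity, transitivity and simultaneous congruence are built in, so a whole reduction
  sequence, at several places at once, is one derivation that resolution can assemble.\<close>

inductive
  vred :: "'l val \<Rightarrow> 'l val \<Rightarrow> bool" and
  cred :: "'l comp \<Rightarrow> 'l comp \<Rightarrow> bool"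
where
  vred_refl: "vred V V"
| vred_trans: "vred U V \<Longrightarrow> vred V W \<Longrightarrow> vred U W"
| cred_refl: "cred M M"
| cred_trans: "cred L M \<Longrightarrow> cred M N \<Longrightarrow> cred L N"
| red_lam: "cred M M' \<Longrightarrow> vred (VLam M) (VLam M')"
| red_tup: "fmdom Vs = fmdom Vs' \<Longrightarrow>
    (\<And>i V V'. fmlookup Vs i = Some V \<Longrightarrow> fmlookup Vs' i = Some V' \<Longrightarrow> vred V V') \<Longrightarrow>
    vred (VTup Vs) (VTup Vs')"
| red_prj: "vred V V' \<Longrightarrow> vred (VPrj i V) (VPrj i V')"
| red_app: "vred V V' \<Longrightarrow> vred W W' \<Longrightarrow> cred (CApp V W) (CApp V' W')"
| red_ret: "vred V V' \<Longrightarrow> cred (CRet V) (CRet V')"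
| red_let: "cred M M' \<Longrightarrow> cred N N' \<Longrightarrow> cred (CLet M N) (CLet M' N')"
| red_op: "vred V V' \<Longrightarrow> cred (COp l V) (COp l V')"
| red_handle: "cred M M' \<Longrightarrow> fmdom H = fmdom H' \<Longrightarrow>
    (\<And>l P P'. fmlookup H l = Some P \<Longrightarrow> fmlookup H' l = Some P' \<Longrightarrow> cred P P') \<Longrightarrow>
    cred N N' \<Longrightarrow> cred (CHandle M H N) (CHandle M' H' N')"
| red_beta: "cred (CApp (VLam M) V) (inst M V)"
| red_prj_tup: "fmlookup Vs i = Some V \<Longrightarrow> vred (VPrj i (VTup Vs)) V"
| red_let_ret: "cred (CLet (CRet V) N) (inst N V)"
| red_let_assoc: "cred (CLet (CLet L M) N) (CLet L (CLet M (wk_comp1 N)))"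
| red_handle_ret: "cred (CHandle (CRet V) H N) (inst N V)"
| red_handle_let: "cred (CHandle (CLet L M) H N)
    (CHandle L H (CHandle M (wk_handler H) (wk_comp1 N)))"
| red_handle_op: "fmlookup H l = Some P \<Longrightarrow> cred (CHandle (COp l V) H N) (inst2 P V (VLam N))"

lemma red_sub:
  "vred V W \<Longrightarrow> vred (sub_val V s) (sub_val W s)"
  "cred M N \<Longrightarrow> cred (sub_comp M s) (sub_comp N s)"
proof (induction arbitrary: s and s rule: vred_cred.inducts)
  case (vred_trans U V W)
  then show ?case by (blast intro: vred_cred.vred_trans)
next
  case (cred_trans L M N)
  then show ?case by (blast intro: vred_cred.cred_trans)
next
  case (red_tup Vs Vs')
  then show ?case by (auto intro!: vred_cred.red_tup)
next
  case (red_handle M M' H H' N N')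
  then show ?case by (auto intro!: vred_cred.red_handle)
next
  case (red_let_assoc L M N)
  show ?case
    using vred_cred.red_let_assoc[of "sub_comp L s" "sub_comp M (up_sub s)" "sub_comp N (up_sub s)"]
    by (simp only: sub_comp.simps sub_wk_comp1)
next
  case (red_handle_let L M H N)
  show ?case
    using vred_cred.red_handle_let[of "sub_comp L s" "sub_comp M (up_sub s)"
        "fmmap (\<lambda>P. sub_comp P (up_sub (up_sub s))) H" "sub_comp N (up_sub s)"]
    by (simp only: sub_comp.simps sub_wk_comp1 fmap.map_comp o_def sub_wk_comp2)
next
  case (red_handle_op H l P V N)
  then show ?case
    by (auto simp: sub_inst2 intro: vred_cred.red_handle_op)
qed (auto simp: sub_inst intro: vred_refl cred_refl red_lam red_prj red_app red_ret red_let red_op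
    red_beta red_prj_tup red_let_ret red_handle_ret)

lemma red_up_sub: "(\<And>n. vred (s n) (t n)) \<Longrightarrow> vred (up_sub s n) (up_sub t n)"
  by (cases n) (auto simp: ren_eq_sub intro: red_sub vred_refl)

text \<open>Reducing a substituted value reduces all its copies, also below binders. Through
  \<open>vred_meta\<close> this permits reduction in the argument of an unknown
  representative.\<close>

lemma red_sub_cong:
  fixes V :: "'l val" and M :: "'l comp"
  shows "(\<And>n. vred (s n) (t n)) \<Longrightarrow> vred (sub_val V s) (sub_val V t)"
    and "(\<And>n. vred (s n) (t n)) \<Longrightarrow> cred (sub_comp M s) (sub_comp M t)"
proof (induction V and M arbitrary: s t and s t rule: val.induct comp.induct)
  case (VTup Vs)
  show ?case by (auto intro!: red_tup VTup.IH VTup.prems fmran'I)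
next
  case (CHandle M H N)
  have "cred P P'" if "fmlookup (fmmap (\<lambda>P. sub_comp P (up_sub (up_sub s))) H) l = Some P"
    "fmlookup (fmmap (\<lambda>P. sub_comp P (up_sub (up_sub t))) H) l = Some P'" for l P P'
    using that by (auto intro!: CHandle.IH(2) red_up_sub CHandle.prems intro: fmran'I)
  then show ?case by (auto intro!: red_handle red_up_sub CHandle.IH(1,3) CHandle.prems)
next
  case (VLam M)
  show ?case by (auto intro!: red_lam VLam.IH red_up_sub VLam.prems)
next
  case (CLet M N)
  show ?case by (auto intro!: red_let CLet.IH red_up_sub CLet.prems)
qed (auto intro!: vred_refl red_prj red_app red_ret red_op)

text \<open>Inverting the typing of the redex recovers every typing premise of the corresponding
  law, so typing the source suffices. Since \<open>eq_typed\<close> then types the target, subject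
  reduction comes with it; this is what carries the transitivity cases.\<close>

lemma red_sound:
  "vred V W \<Longrightarrow> \<Gamma> \<turnstile>\<^sub>v V : A \<Longrightarrow> \<Gamma> \<turnstile>\<^sub>v V \<approx> W : A"
  "cred M N \<Longrightarrow> \<Gamma> \<turnstile>\<^sub>c M : C \<Longrightarrow> \<Gamma> \<turnstile>\<^sub>c M \<approx> N : C"
proof (induction arbitrary: \<Gamma> A and \<Gamma> C rule: vred_cred.inducts)
  case (vred_trans U V W)
  then show ?case by (blast intro: veq_trans dest: eq_typed)
next
  case (cred_trans L M N)
  then show ?case by (blast intro: ceq_trans dest: eq_typed)
next
  case (red_lam M M')
  from red_lam.prems show ?case by (rule vty_lamE) (auto intro!: cong_lam red_lam.IH)
next
  case (red_tup Vs Vs')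
  from red_tup.prems show ?case
  proof (rule vty_tupE)
    fix As assume A: "A = TProd As" "fmdom Vs = fmdom As"
      "\<And>i V A. fmlookup Vs i = Some V \<Longrightarrow> fmlookup As i = Some A \<Longrightarrow> \<Gamma> \<turnstile>\<^sub>v V : A"
    show ?case unfolding A(1)
      by (rule cong_tup) (use A red_tup in auto)
  qed
next
  case (red_prj V V' i)
  from red_prj.prems show ?case by (rule vty_prjE) (auto intro: cong_prj red_prj.IH)
next
  case (red_app V V' W W')
  from red_app.prems show ?case by (rule cty_appE) (auto intro: cong_app red_app.IH)
next
  case (red_ret V V')
  from red_ret.prems show ?case by (rule cty_retE) (auto intro!: cong_ret red_ret.IH)
next
  case (red_let M M' N N')
  from red_let.prems show ?case by (rule cty_letE) (auto intro: cong_let red_let.IH)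
next
  case (red_op V V' l)
  from red_op.prems show ?case by (rule cty_opE) (auto intro: cong_op red_op.IH)
next
  case (red_handle M M' H H' N N')
  from red_handle.prems show ?case
  proof (rule cty_handleE)
    fix A S assume A: "\<Gamma> \<turnstile>\<^sub>c M : CTy A S" "fmdom H = fmdom S"
      "\<And>l A' B' P. fmlookup S l = Some (A', B') \<Longrightarrow> fmlookup H l = Some P \<Longrightarrow> TFun B' C # A' # \<Gamma> \<turnstile>\<^sub>c P : C"
      "A # \<Gamma> \<turnstile>\<^sub>c N : C"
    show ?case
      by (rule cong_handle[where S=S and A=A]) (use A red_handle in auto)
  qed
next
  case (red_beta M V)
  from red_beta.prems show ?case by (rule cty_appE) (auto elim: vty_lamE intro: beta_fun)
next
  case (red_prj_tup Vs i V)
  from red_prj_tup.prems obtain As where "\<Gamma> \<turnstile>\<^sub>v VTup Vs : TProd As" "fmlookup As i = Some A"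
    by (rule vty_prjE)
  then show ?case using red_prj_tup by (blast intro: beta_prod)
next
  case (red_let_ret V N)
  from red_let_ret.prems show ?case by (rule cty_letE) (auto elim!: cty_retE intro: let_ret)
next
  case (red_let_assoc L M N)
  from red_let_assoc.prems show ?case by (rule cty_letE) (auto elim!: cty_letE intro: let_assoc)
next
  case (red_handle_ret V H N)
  from red_handle_ret.prems show ?case
  proof (rule cty_handleE)
    fix A S assume A: "\<Gamma> \<turnstile>\<^sub>c CRet V : CTy A S" "fmdom H = fmdom S"
      "\<And>l A' B' P. fmlookup S l = Some (A', B') \<Longrightarrow> fmlookup H l = Some P \<Longrightarrow> TFun B' C # A' # \<Gamma> \<turnstile>\<^sub>c P : C"
      "A # \<Gamma> \<turnstile>\<^sub>c N : C"
    from A(1) have "\<Gamma> \<turnstile>\<^sub>v V : A" by (rule cty_retE) auto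
    then show ?case by (rule handle_ret[where S=S]) (use A in auto)
  qed
next
  case (red_handle_let L M H N)
  from red_handle_let.prems show ?case
  proof (rule cty_handleE)
    fix A S assume A: "\<Gamma> \<turnstile>\<^sub>c CLet L M : CTy A S" "fmdom H = fmdom S"
      "\<And>l A' B' P. fmlookup S l = Some (A', B') \<Longrightarrow> fmlookup H l = Some P \<Longrightarrow> TFun B' C # A' # \<Gamma> \<turnstile>\<^sub>c P : C"
      "A # \<Gamma> \<turnstile>\<^sub>c N : C"
    from A(1) show ?case
    proof (rule cty_letE)
      fix A0 S0 B0 assume B: "CTy A S = CTy B0 S0" "\<Gamma> \<turnstile>\<^sub>c L : CTy A0 S0" "A0 # \<Gamma> \<turnstile>\<^sub>c M : CTy B0 S0"
      show ?case by (rule handle_let[where S=S and A=A0 and B=A]) (use A B in auto)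
    qed
  qed
next
  case (red_handle_op H l P V N)
  from red_handle_op.prems show ?case
  proof (rule cty_handleE)
    fix A S assume A: "\<Gamma> \<turnstile>\<^sub>c COp l V : CTy A S" "fmdom H = fmdom S"
      "\<And>l A' B' P. fmlookup S l = Some (A', B') \<Longrightarrow> fmlookup H l = Some P \<Longrightarrow> TFun B' C # A' # \<Gamma> \<turnstile>\<^sub>c P : C"
      "A # \<Gamma> \<turnstile>\<^sub>c N : C"
    from A(1) show ?case
    proof (rule cty_opE)
      fix S0 A0 B0 assume B: "CTy A S = CTy B0 S0" "fmlookup S0 l = Some (A0, B0)" "\<Gamma> \<turnstile>\<^sub>v V : A0"
      show ?case by (rule handle_op[where S=S and A=A0 and B=A]) (use A B red_handle_op in auto)
    qed
  qed
qed (auto intro: veq_refl ceq_refl)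

section \<open>Pairs, the unit type and thunks\<close>

lemma fmlookup_two [simp]:
  "fmlookup (two a b) (Num (Suc 0)) = Some a" "fmlookup (two a b) (Num 2) = Some b"
  by (simp_all add: two_def)

lemma fmlookup_two_iff:
  "fmlookup (two a b) i = Some x \<longleftrightarrow> i = Num 1 \<and> x = a \<or> i = Num 2 \<and> x = b"
  by (auto simp: two_def)

lemma fmdom_two [simp]: "fmdom (two a b) = {|Num 1, Num 2|}"
  by (simp add: two_def)

lemma fmmap_two [simp]: "fmmap f (two a b) = two (f a) (f b)"
  by (rule fmap_ext) (simp add: two_def)

lemma red_pair: "vred V V' \<Longrightarrow> vred W W' \<Longrightarrow> vred (VPair V W) (VPair V' W')"
  by (rule red_tup) (auto simp: fmlookup_two_iff)

lemma ty_pair: "\<Gamma> \<turnstile>\<^sub>v V : A \<Longrightarrow> \<Gamma> \<turnstile>\<^sub>v W : B \<Longrightarrow> \<Gamma> \<turnstile>\<^sub>v VPair V W : TPair A B"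
  by (rule ty_tup) (auto simp: fmlookup_two_iff)

lemma ty_fst: "\<Gamma> \<turnstile>\<^sub>v V : TPair A B \<Longrightarrow> \<Gamma> \<turnstile>\<^sub>v VFst V : A"
  by (erule ty_prj) simp

lemma ty_snd: "\<Gamma> \<turnstile>\<^sub>v V : TPair A B \<Longrightarrow> \<Gamma> \<turnstile>\<^sub>v VSnd V : B"
  by (erule ty_prj) simp

lemma ty_unit: "\<Gamma> \<turnstile>\<^sub>v VUnit : TUnit"
  by (rule ty_tup) auto

lemma eta_pair:
  assumes "\<Gamma> \<turnstile>\<^sub>v V : TPair A B"
  shows "\<Gamma> \<turnstile>\<^sub>v VPair (VFst V) (VSnd V) \<approx> V : TPair A B"
proof -
  have "fmmap_keys (\<lambda>i _. VPrj i V) (two A B) = two (VFst V) (VSnd V)"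
    by (rule fmap_ext) (auto simp: two_def)
  with eta_prod[OF assms] show ?thesis by (auto intro: veq_sym)
qed

lemma eta_unit:
  fixes V :: "'a val"
  shows "\<Gamma> \<turnstile>\<^sub>v V : TUnit \<Longrightarrow> \<Gamma> \<turnstile>\<^sub>v V \<approx> VUnit : TUnit"
proof -
  have "fmmap_keys (\<lambda>i _. VPrj i V) (fmempty :: ('a idx, 'a ty) fmap) = fmempty"
    by (rule fmap_ext) simp
  then show "\<Gamma> \<turnstile>\<^sub>v V : TUnit \<Longrightarrow> \<Gamma> \<turnstile>\<^sub>v V \<approx> VUnit : TUnit" using eta_prod[of \<Gamma> V fmempty] by simp
qed

text \<open>Function eta gives an application to the bound variable, which has type
  \<open>TUnit\<close> and is therefore provably \<open>VUnit\<close>.\<close>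

lemma eta_thunk:
  assumes "\<Gamma> \<turnstile>\<^sub>v V : TFun TUnit C"
  shows "\<Gamma> \<turnstile>\<^sub>v V \<approx> VLam (CApp (wk_val V) VUnit) : TFun TUnit C"
  by (rule veq_trans[OF eta_fun[OF assms]])
    (auto intro!: cong_lam cong_app eta_unit veq_refl ty_wk assms ty_var')

lemma thunk_eqI:
  assumes "\<Gamma> \<turnstile>\<^sub>v V : TFun TUnit C" "\<Gamma> \<turnstile>\<^sub>v W : TFun TUnit C"
    and "\<Gamma> \<turnstile>\<^sub>c CApp V VUnit \<approx> CApp W VUnit : C"
  shows "\<Gamma> \<turnstile>\<^sub>v V \<approx> W : TFun TUnit C"
proof -
  \<comment> \<open>The hypothesis is weakened by the variable of the abstraction about to be
    formed; weakening is phrased as a substitution so that \<open>eq_sub\<close> applies.\<close>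
  have "TUnit # \<Gamma> \<turnstile>\<^sub>c sub_comp (CApp V VUnit) (\<lambda>n. VVar (Suc n)) \<approx> sub_comp (CApp W VUnit) (\<lambda>n. VVar (Suc n)) : C"
    by (rule eq_sub(2)[OF assms(3)]) (auto simp: sub_ty_def intro: ty_var')
  then have "\<Gamma> \<turnstile>\<^sub>v VLam (CApp (wk_val V) VUnit) \<approx> VLam (CApp (wk_val W) VUnit) : TFun TUnit C"
    by (simp add: ren_eq_sub cong_lam)
  then show ?thesis using eta_thunk[OF assms(1)] eta_thunk[OF assms(2)] by (meson veq_sym veq_trans)
qed

section \<open>The term category\<close>

text \<open>\<open>is_arr f A B V\<close> names a representative of \<open>f\<close>. Its introduction rules below follow the syntax of
  categorical expressions and so compute, by resolution, the term denoted by such an expression.\<close>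

definition is_arr :: "'l tarr \<Rightarrow> 'l ty \<Rightarrow> 'l ty \<Rightarrow> 'l val \<Rightarrow> bool" where
  "is_arr f A B V \<longleftrightarrow> f = arr A B V \<and> [A] \<turnstile>\<^sub>v V : B"

lemma cls_cong: "[A] \<turnstile>\<^sub>v V \<approx> W : B \<Longrightarrow> cls A B V = cls A B W"
  unfolding cls_def by (auto intro: veq_sym veq_trans)

lemma mem_cls: "W \<in> cls A B V \<longleftrightarrow> [A] \<turnstile>\<^sub>v V \<approx> W : B"
  by (simp add: cls_def)

lemma is_arr_conv: "is_arr f A B V \<Longrightarrow> [A] \<turnstile>\<^sub>v V \<approx> W : B \<Longrightarrow> is_arr f A B W"
  by (auto simp: is_arr_def arr_def cls_cong dest: eq_typed)

lemma is_arr_red: "is_arr f A B V \<Longrightarrow> vred V W \<Longrightarrow> is_arr f A B W"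
  by (rule is_arr_conv) (auto simp: is_arr_def intro: red_sound)

lemma is_arr_unique: "is_arr f A B V \<Longrightarrow> is_arr g A B W \<Longrightarrow> [A] \<turnstile>\<^sub>v V \<approx> W : B \<Longrightarrow> f = g"
  by (auto simp: is_arr_def arr_def cls_cong)

lemma is_arr_veq: "is_arr f A B V \<Longrightarrow> is_arr f A B W \<Longrightarrow> [A] \<turnstile>\<^sub>v V \<approx> W : B"
  by (auto simp: is_arr_def arr_def cls_def intro: veq_refl)

lemma is_arr_ty: "is_arr f A B V \<Longrightarrow> [A] \<turnstile>\<^sub>v V : B"
  by (simp add: is_arr_def)

lemma is_arr_Hom: "is_arr f A B V \<Longrightarrow> f \<in> Hom term_cat A B"
  by (auto simp: is_arr_def Hom_def term_cat_def arr_def)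

lemma Hom_is_arr: "f \<in> Hom term_cat A B \<Longrightarrow> \<exists>V. is_arr f A B V"
  by (auto simp: is_arr_def Hom_def term_cat_def arr_def)

lemma sub_val_var0: "[A] \<turnstile>\<^sub>v V : B \<Longrightarrow> sub_val V (\<lambda>_. VVar 0) = V"
  using sub_typed_cong(1)[of "[A]" V B "\<lambda>_. VVar 0" VVar] by simp

text \<open>An unknown representative is kept in the form \<open>sub_val V (\<lambda>_. W)\<close>, which is stable under renaming
  and substitution.\<close>

lemma HomE:
  assumes "f \<in> Hom term_cat A B"
  obtains V where "[A] \<turnstile>\<^sub>v V : B" "is_arr f A B (sub_val V (\<lambda>_. VVar 0))"
  using Hom_is_arr[OF assms] by (auto simp: sub_val_var0 is_arr_def)

lemma is_arr_Dom: "is_arr f A B V \<Longrightarrow> Dom term_cat f = A"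
  and is_arr_Cod: "is_arr f A B V \<Longrightarrow> Cod term_cat f = B"
  by (auto dest!: is_arr_Hom simp: Hom_def)

lemma sub_ty1: "\<Delta> \<turnstile>\<^sub>v V : A \<Longrightarrow> sub_ty (\<lambda>_. V) [A] \<Delta>"
  by (auto simp: sub_ty_def)

lemma sub_eq1: "\<Delta> \<turnstile>\<^sub>v V \<approx> W : A \<Longrightarrow> sub_eq (\<lambda>_. V) (\<lambda>_. W) [A] \<Delta>"
  by (auto simp: sub_eq_def)

text \<open>Independence of composition from both representatives: \<open>eq_sub\<close> changes the
  outer term, then \<open>sub_cong\<close> the inner one.\<close>

lemma subst1_eq:
  assumes "[B] \<turnstile>\<^sub>v W \<approx> W' : D" "\<Gamma> \<turnstile>\<^sub>v V \<approx> V' : B"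
  shows "\<Gamma> \<turnstile>\<^sub>v sub_val W (\<lambda>_. V) \<approx> sub_val W' (\<lambda>_. V') : D"
proof -
  have "\<Gamma> \<turnstile>\<^sub>v V : B" "[B] \<turnstile>\<^sub>v W' : D" using assms by (auto dest: eq_typed)
  then show ?thesis
    by (rule veq_trans[OF eq_sub(1)[OF assms(1) sub_ty1] sub_cong(1)[OF _ sub_eq1[OF assms(2)]]])
qed

text \<open>Operations on arrows are unions over representatives; such a union is a single class
  once a representative exists and all of them give the same class.\<close>

lemma UN_const_eq: "a \<in> X \<Longrightarrow> (\<And>x. x \<in> X \<Longrightarrow> f x = Z) \<Longrightarrow> (\<Union>x\<in>X. f x) = Z"
  by auto

lemma is_arr_comp:
  assumes "is_arr f A B V" "is_arr g B D W"
  shows "is_arr (Cmp term_cat g f) A D (sub_val W (\<lambda>_. V))"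
proof -
  have V: "[A] \<turnstile>\<^sub>v V : B" and W: "[B] \<turnstile>\<^sub>v W : D"
    and f: "f = (A, B, cls A B V)" and g: "g = (B, D, cls B D W)"
    using assms by (auto simp: is_arr_def arr_def)
  have "(\<Union>V'\<in>cls A B V. cls A D (subst1 W' V')) = cls A D (sub_val W (\<lambda>_. V))"
    if "W' \<in> cls B D W" for W'
    by (rule UN_const_eq[of V])
      (use that V in \<open>auto simp: mem_cls subst1_def intro!: veq_refl cls_cong[symmetric] intro: subst1_eq\<close>)
  then have "(\<Union>W'\<in>cls B D W. \<Union>V'\<in>cls A B V. cls A D (subst1 W' V')) = cls A D (sub_val W (\<lambda>_. V))"
    by (rule UN_const_eq[of W, rotated]) (use W in \<open>auto simp: mem_cls intro: veq_refl\<close>)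
  moreover have "[A] \<turnstile>\<^sub>v sub_val W (\<lambda>_. V) : D" by (rule ty_sub(1)[OF W sub_ty1[OF V]])
  ultimately show ?thesis unfolding f g by (simp add: is_arr_def term_cat_def term_comp_def arr_def)
qed

text \<open>\<open>fmrel\<close> forces a family of representatives to have the domain of
  \<open>fs\<close>, and any two such families agree componentwise up to provable equality. Hence
  \<open>cong_tup\<close> makes all members of the union equal.\<close>

lemma is_arr_tuple:
  assumes dom: "fmdom fs = fmdom Vs"
    and fs: "\<And>i f V. fmlookup fs i = Some f \<Longrightarrow> fmlookup Vs i = Some V \<Longrightarrow> is_arr f D (Cod term_cat f) V"
  shows "is_arr (Tpl term_cat D fs) D (TProd (fmmap (Cod term_cat) fs)) (VTup Vs)"
proof -
  let ?P = "TProd (fmmap (Cod term_cat) fs)"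
  have dom': "fmlookup fs i = None \<longleftrightarrow> fmlookup Vs i = None" for i
    using dom by (metis fmdom_notD fmdom_notI)
  have ty: "[D] \<turnstile>\<^sub>v VTup Vs : ?P"
  proof (rule ty_tup)
    fix i V A assume i: "fmlookup Vs i = Some V" "fmlookup (fmmap (Cod term_cat) fs) i = Some A"
    then obtain f where "fmlookup fs i = Some f" "A = Cod term_cat f" by (auto simp del: split_paired_Ex)
    then show "[D] \<turnstile>\<^sub>v V : A" using is_arr_ty[OF fs] i(1) by simp
  qed (simp add: dom)
  have P: "TProd (fmmap (\<lambda>(_, B, _). B) fs) = ?P"
    by (simp add: term_cat_def)
  have rep: "V \<in> snd (snd f) \<longleftrightarrow> [D] \<turnstile>\<^sub>v W \<approx> V : Cod term_cat f"
    if "fmlookup fs i = Some f" "fmlookup Vs i = Some W" for i f V W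
    using fs[OF that] unfolding is_arr_def arr_def by (metis mem_cls snd_conv)
  have "(\<Union>Us\<in>{Us. fmrel (\<lambda>V (_, _, c). V \<in> c) Us fs}. cls D ?P (VTup Us)) = cls D ?P (VTup Vs)"
  proof (rule UN_const_eq[of Vs])
    have self: "V \<in> snd (snd f)" if "fmlookup fs i = Some f" "fmlookup Vs i = Some V" for i f V
      using rep[OF that] veq_refl[OF is_arr_ty[OF fs[OF that]]] by simp
    have "rel_option (\<lambda>V (_, _, c). V \<in> c) (fmlookup Vs i) (fmlookup fs i)" for i
      using dom'[of i] self[of i]
      by (cases "fmlookup Vs i"; cases "fmlookup fs i") (auto split: prod.splits)
    then show "Vs \<in> {Us. fmrel (\<lambda>V (_, _, c). V \<in> c) Us fs}" by (auto simp: fmrel_iff)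
  next
    fix Us assume "Us \<in> {Us. fmrel (\<lambda>V (_, _, c). V \<in> c) Us fs}"
    then have r: "rel_option (\<lambda>V (_, _, c). V \<in> c) (fmlookup Us i) (fmlookup fs i)" for i
      by (auto simp: fmrel_iff)
    have "fmlookup Us i = None \<longleftrightarrow> fmlookup fs i = None" for i
      using r[of i] by (cases "fmlookup Us i"; cases "fmlookup fs i") simp_all
    then have domU: "fmdom Us = fmdom fs"
      by (intro fset_eqI) (metis fmdom_notD fmdom_notI)
    have "[D] \<turnstile>\<^sub>v VTup Vs \<approx> VTup Us : ?P"
    proof (rule cong_tup)
      fix i V V' A
      assume i: "fmlookup Vs i = Some V" "fmlookup Us i = Some V'" "fmlookup (fmmap (Cod term_cat) fs) i = Some A"
      then obtain f where f: "fmlookup fs i = Some f" "A = Cod term_cat f" by auto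
      have "V' \<in> snd (snd f)" using r[of i] i f by (auto split: prod.splits)
      then show "[D] \<turnstile>\<^sub>v V \<approx> V' : A" using rep[OF f(1) i(1)] f(2) by simp
    qed (use dom domU in auto)
    then show "cls D ?P (VTup Us) = cls D ?P (VTup Vs)" by (rule cls_cong[symmetric])
  qed
  then have "term_tuple D fs = arr D ?P (VTup Vs)"
    unfolding term_tuple_def P Let_def arr_def by simp
  then show ?thesis using ty by (simp add: is_arr_def term_cat_def)
qed

lemma is_arr_prj:
  assumes "fmlookup As i = Some A"
  shows "is_arr (Prj term_cat As i) (TProd As) A (VPrj i (VVar 0))"
  using assms by (auto simp: is_arr_def term_cat_def intro!: ty_prj ty_var')

lemma is_arr_id: "is_arr (Idn term_cat A) A A (VVar 0)"
  by (auto simp: is_arr_def term_cat_def intro!: ty_var')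

lemma Bin_term_cat [simp]: "Bin term_cat A B = TPair A B"
  by (simp add: Bin_def term_cat_def)

lemma One_term_cat [simp]: "One term_cat = TUnit"
  by (simp add: One_def term_cat_def)

lemma Prd_term_cat [simp]: "Prd term_cat = TProd"
  by (simp add: term_cat_def)

lemma Obj_term_cat [simp]: "Obj term_cat = UNIV"
  by (simp add: term_cat_def)

lemma is_arr_fst: "is_arr (Fst term_cat A B) (TPair A B) A (VFst (VVar 0))"
  unfolding Fst_def by (rule is_arr_prj) simp

lemma is_arr_snd: "is_arr (Snd term_cat A B) (TPair A B) B (VSnd (VVar 0))"
  unfolding Snd_def by (rule is_arr_prj) simp

lemma is_arr_bang: "is_arr (Bang term_cat A) A TUnit VUnit"
  using is_arr_tuple[of fmempty fmempty A] by (simp add: Bang_def)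

lemma is_arr_pairing:
  assumes "is_arr f D A V" "is_arr g D B W"
  shows "is_arr (Pairing term_cat f g) D (TPair A B) (VPair V W)"
proof -
  have "is_arr h D (Cod term_cat h) U"
    if "fmlookup (two f g) i = Some h" "fmlookup (two V W) i = Some U" for i h U
    using that assms unfolding fmlookup_two_iff by (elim disjE conjE) (simp_all add: is_arr_Cod)
  then have "is_arr (Tpl term_cat D (two f g)) D (TProd (fmmap (Cod term_cat) (two f g))) (VTup (two V W))"
    by (intro is_arr_tuple) auto
  then show ?thesis
    by (simp add: Pairing_def is_arr_Dom[OF assms(1)] is_arr_Cod[OF assms(1)] is_arr_Cod[OF assms(2)])
qed

lemma is_arr_times:
  assumes "is_arr f A A' V" "is_arr g B B' W"
  shows "is_arr (Times term_cat f g) (TPair A B) (TPair A' B')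
    (VPair (sub_val V (\<lambda>_. VFst (VVar 0))) (sub_val W (\<lambda>_. VSnd (VVar 0))))"
  unfolding Times_def is_arr_Dom[OF assms(1)] is_arr_Dom[OF assms(2)]
  by (intro is_arr_pairing is_arr_comp[OF is_arr_fst assms(1)] is_arr_comp[OF is_arr_snd assms(2)])

lemma cartesian_term_cat: "cartesian_category (term_cat :: ('l ty, 'l tarr, 'l) cart)"
proof
  fix f :: "'l tarr" and A B assume "f \<in> Hom term_cat A B"
  then obtain V where V: "[A] \<turnstile>\<^sub>v V : B" "is_arr f A B (sub_val V (\<lambda>_. VVar 0))" by (rule HomE)
  show "Cmp term_cat (Idn term_cat B) f = f"
    using is_arr_comp[OF V(2) is_arr_id] V by (simp add: is_arr_def)
  show "Cmp term_cat f (Idn term_cat A) = f"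
    using is_arr_comp[OF is_arr_id V(2)] V by (simp add: is_arr_def)
next
  fix f g h :: "'l tarr" and A B D E
  assume "f \<in> Hom term_cat A B" "g \<in> Hom term_cat B D" "h \<in> Hom term_cat D E"
  then obtain U V W where *: "is_arr f A B U" "is_arr g B D V" "is_arr h D E W"
    by (meson Hom_is_arr)
  \<comment> \<open>Fusion of substitutions gives both bracketings literally the same
    representative.\<close>
  show "Cmp term_cat (Cmp term_cat h g) f = Cmp term_cat h (Cmp term_cat g f)"
    using is_arr_comp[OF *(1) is_arr_comp[OF *(2,3)]] is_arr_comp[OF is_arr_comp[OF *(1,2)] *(3)]
    by (simp add: is_arr_def)
next
  fix f g :: "'l tarr" and A B D
  assume "f \<in> Hom term_cat A B" "g \<in> Hom term_cat B D"
  then show "Cmp term_cat g f \<in> Hom term_cat A D"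
    by (meson Hom_is_arr is_arr_Hom is_arr_comp)
next
  fix D :: "'l ty" and fs :: "('l idx, 'l tarr) fmap"
  assume "fmpred (\<lambda>_ f. f \<in> Arr term_cat \<and> Dom term_cat f = D) fs"
  then have hom: "f \<in> Hom term_cat D (Cod term_cat f)" if "fmlookup fs i = Some f" for i f
    using that by (auto simp: Hom_def dest: fmpredD)
  \<comment> \<open>Tupling needs one term per component, so a representative of each arrow of the
    family is chosen.\<close>
  define rep where "rep f = (SOME V. is_arr f D (Cod term_cat f) V)" for f
  have rep: "is_arr f D (Cod term_cat f) (rep f)" if "fmlookup fs i = Some f" for i f
    unfolding rep_def by (rule someI_ex) (rule Hom_is_arr[OF hom[OF that]])
  let ?P = "Prd term_cat (fmmap (Cod term_cat) fs)"
  have T: "is_arr (Tpl term_cat D fs) D (TProd (fmmap (Cod term_cat) fs)) (VTup (fmmap rep fs))"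
    by (rule is_arr_tuple) (auto intro: rep)
  then show "Tpl term_cat D fs \<in> Hom term_cat D ?P" by (simp add: is_arr_Hom)
  have prj: "is_arr (Cmp term_cat (Prj term_cat (fmmap (Cod term_cat) fs) i) h) D (Cod term_cat f) (VPrj i V)"
    if "fmlookup fs i = Some f" "is_arr h D (TProd (fmmap (Cod term_cat) fs)) V" for i f h V
    using is_arr_comp[OF that(2) is_arr_prj[of "fmmap (Cod term_cat) fs" i "Cod term_cat f"]] that(1) by simp
  show "Cmp term_cat (Prj term_cat (fmmap (Cod term_cat) fs) i) (Tpl term_cat D fs) = f"
    if i: "fmlookup fs i = Some f" for i f
    by (rule is_arr_unique[OF is_arr_red[OF prj[OF i T] red_prj_tup] rep[OF i]])
      (use i rep[OF i] in \<open>auto intro: veq_refl is_arr_ty\<close>)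
  fix h assume "h \<in> Hom term_cat D ?P"
    and h: "\<And>i f. fmlookup fs i = Some f \<Longrightarrow> Cmp term_cat (Prj term_cat (fmmap (Cod term_cat) fs) i) h = f"
  then obtain V where V: "is_arr h D (TProd (fmmap (Cod term_cat) fs)) V"
    by (metis Prd_term_cat Hom_is_arr)
  \<comment> \<open>Uniqueness is product eta: \<open>V\<close> is the tuple of its projections, and
    each projection represents the composite of \<open>h\<close> with a product projection, which is
    the prescribed component.\<close>
  have "[D] \<turnstile>\<^sub>v VTup (fmmap_keys (\<lambda>i _. VPrj i V) (fmmap (Cod term_cat) fs)) \<approx> VTup (fmmap rep fs)
      : TProd (fmmap (Cod term_cat) fs)"
  proof (rule cong_tup)
    fix i W W' A
    assume i: "fmlookup (fmmap_keys (\<lambda>i _. VPrj i V) (fmmap (Cod term_cat) fs)) i = Some W"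
      "fmlookup (fmmap rep fs) i = Some W'" "fmlookup (fmmap (Cod term_cat) fs) i = Some A"
    then obtain f where f: "fmlookup fs i = Some f" "W = VPrj i V" "W' = rep f" "A = Cod term_cat f" by auto
    show "[D] \<turnstile>\<^sub>v W \<approx> W' : A"
      using is_arr_veq[OF prj[OF f(1) V, unfolded h[OF f(1)]] rep[OF f(1)]] f by simp
  qed auto
  then show "h = Tpl term_cat D fs"
    by (intro is_arr_unique[OF V T] veq_trans[OF eta_prod[OF is_arr_ty[OF V]]])
qed (auto simp: is_arr_Hom[OF is_arr_id] intro: is_arr_Hom is_arr_prj)

section \<open>The strong Kleisli triple\<close>

text \<open>The format of most law checks below: the \<open>is_arr\<close> rules fill in
  \<open>V\<close> and \<open>W\<close>, the reduction rules fill in \<open>N\<close> and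
  \<open>N'\<close>, and the last premise is what remains to be proved by an excluded law.\<close>

lemma is_arr_thunk_eqI':
  assumes f: "is_arr f A (TT S B) V" and g: "is_arr g A (TT S B) W"
    and "cred (CApp V VUnit) N" "cred (CApp W VUnit) N'" "[A] \<turnstile>\<^sub>c N \<approx> N' : CTy B S"
  shows "f = g"
proof (rule is_arr_unique[OF f g])
  have ty: "[A] \<turnstile>\<^sub>v V : TFun TUnit (CTy B S)" "[A] \<turnstile>\<^sub>v W : TFun TUnit (CTy B S)"
    using f g by (auto simp: is_arr_def TT_def)
  then have "[A] \<turnstile>\<^sub>c CApp V VUnit \<approx> N : CTy B S" "[A] \<turnstile>\<^sub>c CApp W VUnit \<approx> N' : CTy B S"
    by (auto intro: red_sound assms ty_app ty_unit)
  then show "[A] \<turnstile>\<^sub>v V \<approx> W : TT S B"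
    unfolding TT_def using assms(5) by (intro thunk_eqI ty) (blast intro: ceq_sym ceq_trans)
qed

text \<open>The case of identical reducts. Their equality is a separate premise because the two are
  computed independently and match only after simplification.\<close>

lemma is_arr_thunk_eqI:
  assumes f: "is_arr f A (TT S B) V" and g: "is_arr g A (TT S B) W"
    and "cred (CApp V VUnit) N" "cred (CApp W VUnit) N'" "N = N'"
  shows "f = g"
proof (rule is_arr_thunk_eqI'[OF assms(1-4)])
  have "[A] \<turnstile>\<^sub>c CApp V VUnit : CTy B S"
    using f by (auto simp: is_arr_def TT_def intro: ty_app ty_unit)
  with red_sound(2)[OF assms(3)] show "[A] \<turnstile>\<^sub>c N \<approx> N' : CTy B S"
    using assms(5) by (auto intro: ceq_refl dest: eq_typed)
qed

text \<open>Indices such as \<open>2\<close> are numerals, which the rules stated with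
  \<open>Suc\<close> do not match.\<close>

lemma up_sub_numeral [simp]: "up_sub s (numeral k) = ren_val (s (pred_numeral k)) Suc"
  by (simp add: numeral_eq_Suc)

lemma up_ren_numeral [simp]: "up_ren r (numeral k) = Suc (r (pred_numeral k))"
  by (simp add: numeral_eq_Suc)

text \<open>Resolving repeatedly with these rules, in the order listed and starting from an unknown right-hand
  side, computes a reduct: redexes at the head of the evaluation context come before congruences.\<close>

lemma vred_fst: "vred a t \<Longrightarrow> vred (VFst (VPair a b)) t"
  and vred_snd: "vred b t \<Longrightarrow> vred (VSnd (VPair a b)) t"
  by (rule vred_trans[OF red_prj_tup], simp, assumption)+

text \<open>Contracts the inner projection first. The congruence \<open>red_prj\<close> alone would
  leave behind the outer redex that is exposed when the inner value becomes a tuple.\<close>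

lemma vred_prj_fst: "vred (VPrj j a) t \<Longrightarrow> vred (VPrj j (VFst (VPair a b))) t"
  and vred_prj_snd: "vred (VPrj j b) t \<Longrightarrow> vred (VPrj j (VSnd (VPair a b))) t"
  by (rule vred_trans[OF red_prj[OF red_prj_tup]], simp, assumption)+

lemma vred_meta: "vred p q \<Longrightarrow> vred (sub_val F (\<lambda>_. p)) (sub_val F (\<lambda>_. q))"
  by (rule red_sub_cong)

lemmas vred_steps = vred_fst vred_snd vred_prj_fst vred_prj_snd red_pair red_lam red_prj vred_meta vred_refl

lemma red_app_head:
  "cred (CApp (VLam M) V) (inst M V)"
  "cred (CApp (VFst (VPair a b)) V) (CApp a V)"
  "cred (CApp (VSnd (VPair a b)) V) (CApp b V)"
  "cred (CApp (VPrj j (VFst (VPair a b))) V) (CApp (VPrj j a) V)"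
  "cred (CApp (VPrj j (VSnd (VPair a b))) V) (CApp (VPrj j b) V)"
  by (auto intro!: red_beta red_app red_prj vred_refl red_prj_tup)

lemma red_handle_head: "cred M M' \<Longrightarrow> cred (CHandle M H N) (CHandle M' H N)"
  by (rule red_handle) (auto intro: cred_refl)

lemmas cred_app_steps = red_app_head[THEN cred_trans]
lemmas cred_let_steps = red_app_head[THEN red_let[OF _ cred_refl], THEN cred_trans]
  red_let_ret[THEN cred_trans] red_let_assoc[THEN cred_trans]

text \<open>The simplifier rewrites \<open>Num 1\<close> to \<open>Num (Suc 0)\<close>, so rules matched after it need this form.\<close>

lemmas cred_steps = cred_app_steps[unfolded One_nat_def] cred_let_steps[unfolded One_nat_def]
  red_app red_let red_ret red_op cred_refl vred_steps[unfolded One_nat_def]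

lemmas ty_fst' = ty_fst[unfolded One_nat_def]
lemmas eta_pair' = eta_pair[unfolded One_nat_def]

lemma run_cong: "\<Gamma> \<turnstile>\<^sub>v V \<approx> W : TT S A \<Longrightarrow> \<Gamma> \<turnstile>\<^sub>c CApp V VUnit \<approx> CApp W VUnit : CTy A S"
  unfolding TT_def by (rule cong_app) (auto intro: veq_refl ty_unit)

lemma ty_run: "\<Gamma> \<turnstile>\<^sub>v V : TT S A \<Longrightarrow> \<Gamma> \<turnstile>\<^sub>c CApp V VUnit : CTy A S"
  unfolding TT_def by (rule ty_app) (auto intro: ty_unit)

lemma TO_smonad [simp]: "TO (smonad_of term_cat (term_triple S)) = TT S"
  and KO_triple [simp]: "KO (term_triple S) = TT S"
  by (simp_all add: smonad_of_def term_triple_def)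

lemma is_arr_keta: "is_arr (KEta (term_triple S) A) A (TT S A) (VLam (CRet (VVar 1)))"
  by (auto simp: is_arr_def term_triple_def TT_def intro!: ty_lam ty_ret ty_var')

text \<open>\<open>ext_term\<close> with \<open>subst1\<close> unfolded, so that the fusion rules
  for \<open>sub_val\<close> apply directly.\<close>

definition ext_body :: "'l val \<Rightarrow> 'l val" where
  "ext_body V = VLam (CLet (CApp (VSnd (VVar 1)) VUnit)
     (CApp (sub_val V (\<lambda>_. VPair (VFst (VVar 2)) (VVar 0))) VUnit))"

lemma ext_term_body: "ext_term V = ext_body V"
  by (simp add: ext_term_def ext_body_def subst1_def)

text \<open>Shows that strong Kleisli extension does not depend on the representative, which
  collapses the union in its definition.\<close>

lemma ext_body_cong:
  assumes "[TPair A1 A2] \<turnstile>\<^sub>v V \<approx> W : TT S B"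
  shows "[TPair A1 (TT S A2)] \<turnstile>\<^sub>v ext_body V \<approx> ext_body W : TT S B"
  unfolding ext_body_def TT_def
  by (intro cong_lam cong_let[where A=A2] cong_app[where A=TUnit] veq_refl ceq_refl subst1_eq[OF assms[unfolded TT_def]]
      ty_unit ty_app[where A=TUnit] ty_pair ty_fst[where B="TFun TUnit (CTy A2 S)"] ty_snd[where A=A1] ty_var') simp_all

lemma is_arr_kext:
  assumes "is_arr f (TPair A1 A2) (TT S B) V"
  shows "is_arr (KExt (term_triple S) A1 A2 B f) (TPair A1 (TT S A2)) (TT S B) (ext_body V)"
proof -
  have V: "[TPair A1 A2] \<turnstile>\<^sub>v V : TT S B" and f: "f = (TPair A1 A2, TT S B, cls (TPair A1 A2) (TT S B) V)"
    using assms by (auto simp: is_arr_def arr_def)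
  have "(\<Union>W\<in>cls (TPair A1 A2) (TT S B) V. cls (TPair A1 (TT S A2)) (TT S B) (ext_term W)) =
      cls (TPair A1 (TT S A2)) (TT S B) (ext_body V)"
    by (rule UN_const_eq[of V])
      (use V in \<open>auto simp only: mem_cls ext_term_body intro!: veq_refl cls_cong[symmetric] ext_body_cong\<close>)
  moreover have "[TPair A1 (TT S A2)] \<turnstile>\<^sub>v ext_body V : TT S B"
    using ext_body_cong[OF veq_refl[OF V]] by (blast dest: eq_typed)
  ultimately show ?thesis unfolding f by (simp add: is_arr_def term_triple_def arr_def)
qed

lemmas cartesian_is_arr = is_arr_pairing is_arr_times is_arr_comp is_arr_id is_arr_fst is_arr_snd

lemmas triple_is_arr = cartesian_is_arr is_arr_bang is_arr_keta is_arr_kext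

lemma kleisli_term_triple: "strong_kleisli_triple term_cat (term_triple S)"
proof (intro strong_kleisli_triple.intro cartesian_term_cat strong_kleisli_triple_axioms.intro,
    unfold Obj_term_cat Bin_term_cat KO_triple)
  fix A show "KEta (term_triple S) A \<in> Hom term_cat A (TT S A)" by (rule is_arr_Hom[OF is_arr_keta])
next
  fix G A B f assume "f \<in> Hom term_cat (TPair G A) (TT S B)"
  then obtain F where FT: "[TPair G A] \<turnstile>\<^sub>v F : TT S B" and F: "is_arr f (TPair G A) (TT S B) (sub_val F (\<lambda>_. VVar 0))" by (rule HomE)
  show "KExt (term_triple S) G A B f \<in> Hom term_cat (TPair G (TT S A)) (TT S B)"
    by (rule is_arr_Hom[OF is_arr_kext[OF F]])
  show "KExt (term_triple S) G A B f \<odot>\<^bsub>term_cat\<^esub> (Idn term_cat G \<otimes>\<otimes>\<^bsub>term_cat\<^esub> KEta (term_triple S) A) = f"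
    \<comment> \<open>The left reduct runs \<open>F\<close> at the pair of the two projections of
      the variable, the right one at the variable itself; surjective pairing identifies
      them.\<close>
    by (rule is_arr_thunk_eqI', (rule triple_is_arr F)+,
        ((simp add: inst_def ext_body_def)?, rule cred_steps)+,
        (rule run_cong subst1_eq[OF veq_refl[OF FT]] eta_pair' ty_var')+, simp_all)
next
  fix h G' G A B f
  assume "h \<in> Hom term_cat G' G" "f \<in> Hom term_cat (TPair G A) (TT S B)"
  then obtain F H where F: "is_arr f (TPair G A) (TT S B) (sub_val F (\<lambda>_. VVar 0))"
    and H: "is_arr h G' G (sub_val H (\<lambda>_. VVar 0))" by (elim HomE)
  show "KExt (term_triple S) G' A B (f \<odot>\<^bsub>term_cat\<^esub> (h \<otimes>\<otimes>\<^bsub>term_cat\<^esub> Idn term_cat A)) =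
    KExt (term_triple S) G A B f \<odot>\<^bsub>term_cat\<^esub> (h \<otimes>\<otimes>\<^bsub>term_cat\<^esub> Idn term_cat (TT S A))"
    by (rule is_arr_thunk_eqI, (rule triple_is_arr F H)+,
        ((simp add: inst_def ext_body_def)?, rule cred_steps)+, simp)
next
  fix G A
  show "KExt (term_triple S) G A A (KEta (term_triple S) A \<odot>\<^bsub>term_cat\<^esub> Snd term_cat G A) = Snd term_cat G (TT S A)"
    \<comment> \<open>The left reduct is a let that only returns its bound variable.\<close>
    by (rule is_arr_thunk_eqI', (rule triple_is_arr)+,
        ((simp add: inst_def ext_body_def)?, rule cred_steps)+,
        (rule let_eta ty_run ty_snd ty_var')+, simp_all)
next
  fix G A B D f g
  assume "f \<in> Hom term_cat (TPair G A) (TT S B)" "g \<in> Hom term_cat (TPair G B) (TT S D)"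
  then obtain F E where F: "is_arr f (TPair G A) (TT S B) (sub_val F (\<lambda>_. VVar 0))"
    and E: "is_arr g (TPair G B) (TT S D) (sub_val E (\<lambda>_. VVar 0))" by (elim HomE)
  show "KExt (term_triple S) G A D (KExt (term_triple S) G B D g \<odot>\<^bsub>term_cat\<^esub> \<langle>Fst term_cat G A, f\<rangle>\<^bsub>term_cat\<^esub>) =
    KExt (term_triple S) G B D g \<odot>\<^bsub>term_cat\<^esub> \<langle>Fst term_cat G (TT S A), KExt (term_triple S) G A B f\<rangle>\<^bsub>term_cat\<^esub>"
    by (rule is_arr_thunk_eqI, (rule triple_is_arr F E)+,
        ((simp add: inst_def ext_body_def)?, rule cred_steps)+, simp)
qed auto

section \<open>The strong monad\<close>

abbreviation tmonad :: "'l sig \<Rightarrow> ('l ty, 'l tarr) smonad" where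
  "tmonad S \<equiv> smonad_of term_cat (term_triple S)"

lemma is_arr_red_eq: "is_arr f A B V \<Longrightarrow> vred V N \<Longrightarrow> N = W \<Longrightarrow> is_arr f A B W"
  using is_arr_red by blast

text \<open>Here and for \<open>Mu\<close>, reduction projects away the parameter of type
  \<open>TUnit\<close> that \<open>ext1\<close> introduces, leaving the usual let-term.\<close>

lemma is_arr_TM:
  assumes "is_arr f A B V"
  shows "is_arr (TM (tmonad S) f) (TT S A) (TT S B)
    (VLam (CLet (CApp (VVar 1) VUnit) (CRet (sub_val V (\<lambda>_. VVar 0)))))"
  unfolding smonad_of_def ext1_def smonad.simps is_arr_Dom[OF assms] is_arr_Cod[OF assms] KO_triple One_term_cat
  by (rule is_arr_red_eq, (rule triple_is_arr assms)+,
      ((simp add: inst_def ext_body_def)?, rule cred_steps)+, simp)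

lemma is_arr_Mu:
  "is_arr (Mu (tmonad S) A) (TT S (TT S A)) (TT S A)
    (VLam (CLet (CApp (VVar 1) VUnit) (CApp (VVar 0) VUnit)))"
  unfolding smonad_of_def ext1_def smonad.simps KO_triple One_term_cat
  by (rule is_arr_red_eq, (rule triple_is_arr)+,
      ((simp add: inst_def ext_body_def)?, rule cred_steps)+, simp)

lemma is_arr_Str:
  "is_arr (Str (tmonad S) A B) (TPair A (TT S B)) (TT S (TPair A B))
    (VLam (CLet (CApp (VSnd (VVar 1)) VUnit) (CRet (VPair (VFst (VVar 2)) (VVar 0)))))"
  unfolding smonad_of_def smonad.simps Bin_term_cat
  by (rule is_arr_red_eq, (rule triple_is_arr)+,
      ((simp add: inst_def ext_body_def)?, rule cred_steps)+, simp)

lemma is_arr_Eta: "is_arr (Eta (tmonad S) A) A (TT S A) (VLam (CRet (VVar 1)))"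
  unfolding smonad_of_def smonad.simps by (rule is_arr_keta)

lemmas monad_is_arr = cartesian_is_arr is_arr_TM is_arr_Mu is_arr_Str is_arr_Eta

lemma strong_monad_term:
  fixes S :: "'l sig"
  shows "strong_monad term_cat (tmonad S)"
proof (intro strong_monad.intro cartesian_term_cat strong_monad_axioms.intro,
    unfold Obj_term_cat Bin_term_cat One_term_cat TO_smonad Swap_def Assoc_def)
  fix f :: "'l tarr" and A B assume "f \<in> Hom term_cat A B"
  then obtain F where F: "is_arr f A B (sub_val F (\<lambda>_. VVar 0))" by (rule HomE)
  show "TM (tmonad S) f \<in> Hom term_cat (TT S A) (TT S B)"
    by (rule is_arr_Hom[OF is_arr_TM[OF F]])
  show "TM (tmonad S) f \<odot>\<^bsub>term_cat\<^esub> Eta (tmonad S) A = Eta (tmonad S) B \<odot>\<^bsub>term_cat\<^esub> f"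
    by (rule is_arr_thunk_eqI, (rule monad_is_arr F)+,
        ((simp add: inst_def)?, rule cred_steps)+, simp)
  show "TM (tmonad S) f \<odot>\<^bsub>term_cat\<^esub> Mu (tmonad S) A =
    Mu (tmonad S) B \<odot>\<^bsub>term_cat\<^esub> TM (tmonad S) (TM (tmonad S) f)"
    by (rule is_arr_thunk_eqI, (rule monad_is_arr F)+,
        ((simp add: inst_def)?, rule cred_steps)+, simp)
next
  fix A
  show "TM (tmonad S) (Idn term_cat A) = Idn term_cat (TT S A)"
    \<comment> \<open>In this law, in the law for \<open>Mu\<close> after \<open>TM\<close> of
      \<open>Eta\<close>, and in the law for strength at \<open>TUnit\<close>, one side becomes a
      let returning its bound variable; \<open>let_eta\<close> removes it.\<close>
    by (rule is_arr_thunk_eqI', (rule monad_is_arr)+,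
        ((simp add: inst_def)?, rule cred_steps)+,
        (rule let_eta ty_run ty_snd ty_var')+, simp_all)
  show "Mu (tmonad S) A \<odot>\<^bsub>term_cat\<^esub> Eta (tmonad S) (TT S A) = Idn term_cat (TT S A)"
    by (rule is_arr_thunk_eqI, (rule monad_is_arr)+,
        ((simp add: inst_def)?, rule cred_steps)+, simp)
  show "Mu (tmonad S) A \<odot>\<^bsub>term_cat\<^esub> TM (tmonad S) (Eta (tmonad S) A) = Idn term_cat (TT S A)"
    by (rule is_arr_thunk_eqI', (rule monad_is_arr)+,
        ((simp add: inst_def)?, rule cred_steps)+,
        (rule let_eta ty_run ty_snd ty_var')+, simp_all)
  show "Mu (tmonad S) A \<odot>\<^bsub>term_cat\<^esub> Mu (tmonad S) (TT S A) =
         Mu (tmonad S) A \<odot>\<^bsub>term_cat\<^esub> TM (tmonad S) (Mu (tmonad S) A)"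
    by (rule is_arr_thunk_eqI, (rule monad_is_arr)+,
        ((simp add: inst_def)?, rule cred_steps)+, simp)
  show "TM (tmonad S) (Snd term_cat TUnit A) \<odot>\<^bsub>term_cat\<^esub> Str (tmonad S) TUnit A = Snd term_cat TUnit (TT S A)"
    by (rule is_arr_thunk_eqI', (rule monad_is_arr)+,
        ((simp add: inst_def)?, rule cred_steps)+,
        (rule let_eta ty_run ty_snd ty_var')+, simp_all)
next
  fix f g :: "'l tarr" and A B D assume "f \<in> Hom term_cat A B" "g \<in> Hom term_cat B D"
  then obtain F G where F: "is_arr f A B (sub_val F (\<lambda>_. VVar 0))" "is_arr g B D (sub_val G (\<lambda>_. VVar 0))"
    by (elim HomE)
  show "TM (tmonad S) (g \<odot>\<^bsub>term_cat\<^esub> f) = TM (tmonad S) g \<odot>\<^bsub>term_cat\<^esub> TM (tmonad S) f"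
    by (rule is_arr_thunk_eqI, (rule monad_is_arr F)+,
        ((simp add: inst_def)?, rule cred_steps)+, simp)
next
  fix f g :: "'l tarr" and A A' B B' assume "f \<in> Hom term_cat A A'" "g \<in> Hom term_cat B B'"
  then obtain F G where F: "is_arr f A A' (sub_val F (\<lambda>_. VVar 0))" "is_arr g B B' (sub_val G (\<lambda>_. VVar 0))"
    by (elim HomE)
  show "TM (tmonad S) (f \<otimes>\<otimes>\<^bsub>term_cat\<^esub> g) \<odot>\<^bsub>term_cat\<^esub> Str (tmonad S) A B =
    Str (tmonad S) A' B' \<odot>\<^bsub>term_cat\<^esub> (f \<otimes>\<otimes>\<^bsub>term_cat\<^esub> TM (tmonad S) g)"
    by (rule is_arr_thunk_eqI, (rule monad_is_arr F)+,
        ((simp add: inst_def)?, rule cred_steps)+, simp)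
next
  fix A B D
  show "TM (tmonad S)
        \<langle>Fst term_cat A B \<odot>\<^bsub>term_cat\<^esub> Fst term_cat (TPair A B) D, Snd term_cat A B \<otimes>\<otimes>\<^bsub>term_cat\<^esub> Idn term_cat D\<rangle>\<^bsub>term_cat\<^esub> \<odot>\<^bsub>term_cat\<^esub>
       Str (tmonad S) (TPair A B) D =
       Str (tmonad S) A (TPair B D) \<odot>\<^bsub>term_cat\<^esub>
       (Idn term_cat A \<otimes>\<otimes>\<^bsub>term_cat\<^esub> Str (tmonad S) B D) \<odot>\<^bsub>term_cat\<^esub>
       \<langle>Fst term_cat A B \<odot>\<^bsub>term_cat\<^esub> Fst term_cat (TPair A B) (TT S D), Snd term_cat A B \<otimes>\<otimes>\<^bsub>term_cat\<^esub> Idn term_cat (TT S D)\<rangle>\<^bsub>term_cat\<^esub>"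
    by (rule is_arr_thunk_eqI, (rule monad_is_arr)+,
        ((simp add: inst_def)?, rule cred_steps)+, simp)
next
  fix A B
  show "Str (tmonad S) A B \<odot>\<^bsub>term_cat\<^esub> (Idn term_cat A \<otimes>\<otimes>\<^bsub>term_cat\<^esub> Eta (tmonad S) B) = Eta (tmonad S) (TPair A B)"
    \<comment> \<open>The strength splits its argument and rebuilds it, so the returned values
      differ by surjective pairing.\<close>
    by (rule is_arr_thunk_eqI', (rule monad_is_arr)+,
        ((simp add: inst_def)?, rule cred_steps)+,
        (rule cong_ret eta_pair' ty_var')+, simp_all)
  show "Str (tmonad S) A B \<odot>\<^bsub>term_cat\<^esub> (Idn term_cat A \<otimes>\<otimes>\<^bsub>term_cat\<^esub> Mu (tmonad S) B) =
       Mu (tmonad S) (TPair A B) \<odot>\<^bsub>term_cat\<^esub> TM (tmonad S) (Str (tmonad S) A B) \<odot>\<^bsub>term_cat\<^esub> Str (tmonad S) A (TT S B)"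
    by (rule is_arr_thunk_eqI, (rule monad_is_arr)+,
        ((simp add: inst_def)?, rule cred_steps)+, simp)
qed (auto intro: is_arr_Hom monad_is_arr)

section \<open>The model\<close>

lemma cong_pair: "\<Gamma> \<turnstile>\<^sub>v V \<approx> V' : A \<Longrightarrow> \<Gamma> \<turnstile>\<^sub>v W \<approx> W' : B \<Longrightarrow> \<Gamma> \<turnstile>\<^sub>v VPair V W \<approx> VPair V' W' : TPair A B"
  by (rule cong_tup) (auto simp: fmlookup_two_iff)

lemma is_arr_kev:
  "is_arr (term_kev S A B) (TPair (TFun A (CTy B S)) A) (TT S B) (VLam (CApp (VFst (VVar 1)) (VSnd (VVar 1))))"
  unfolding is_arr_def term_kev_def term_kexp_def TT_def
  by (intro conjI refl ty_lam ty_app[where A=A] ty_fst[where B=A] ty_snd[where A="TFun A (CTy B S)"] ty_var') simp_all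

lemma is_arr_opr:
  assumes "fmlookup S l = Some (A, B)"
  shows "is_arr (term_op S l) A (TT S B) (VLam (COp l (VVar 1)))"
  using assms unfolding is_arr_def term_op_def TT_def
  by (auto intro!: ty_lam ty_op[where A=A] ty_var')

text \<open>Since \<open>S\<close> is arbitrary, its clauses cannot be listed one by one.
  Abstracting over the value \<open>V\<close> whose components they call makes the family stable
  under substitution and renaming. The shift by two moves \<open>V\<close> past the two variables
  bound by a clause.\<close>

definition hterm :: "'l sig \<Rightarrow> 'l val \<Rightarrow> ('l, 'l comp) fmap" where
  "hterm S V = fmmap_keys (\<lambda>l _. CApp (VPrj (Lab l) (ren_val V (\<lambda>n. Suc (Suc n)))) (VPair (VVar 1) (VVar 0))) S"

lemma term_handler_eq: "term_handler S = hterm S (VFst (VVar 1))"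
  by (simp add: term_handler_def hterm_def numeral_eq_Suc)

lemma sub_hterm [simp]: "fmmap (\<lambda>P. sub_comp P (up_sub (up_sub s))) (hterm S V) = hterm S (sub_val V s)"
  by (rule fmap_ext) (simp add: hterm_def option.map_comp o_def)

lemma ren_hterm [simp]: "fmmap (\<lambda>P. ren_comp P (up_ren (up_ren r))) (hterm S V) = hterm S (ren_val V r)"
  by (rule fmap_ext) (simp add: hterm_def option.map_comp o_def)

lemma fmlookup_hterm: "fmlookup S l = Some z \<Longrightarrow> fmlookup (hterm S V) l =
  Some (CApp (VPrj (Lab l) (ren_val V (\<lambda>n. Suc (Suc n)))) (VPair (VVar 1) (VVar 0)))"
  by (simp add: hterm_def)

lemma red_hterm: "cred M M' \<Longrightarrow> vred V V' \<Longrightarrow> cred N N' \<Longrightarrow>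
  cred (CHandle M (hterm S V) N) (CHandle M' (hterm S V') N')"
  by (rule red_handle)
    (auto simp: hterm_def ren_eq_sub fset_eq_iff fmlookup_dom_iff intro!: red_app red_prj red_sub vred_refl)

lemma fmlookup_op_family [simp]: "fmlookup (op_family m) (Lab l) = fmlookup m l"
  by (simp add: op_family.rep_eq)

lemma HFam_eq: "TProd (HFam term_cat term_kexp S S' X) = HTy S (CTy X S')"
  by (simp add: HFam_def HTy_def term_kexp_def)

lemma ty_hterm:
  assumes "\<Gamma> \<turnstile>\<^sub>v V : HTy S C" "fmlookup S l = Some (A, B)" "fmlookup (hterm S V) l = Some P"
  shows "TFun B C # A # \<Gamma> \<turnstile>\<^sub>c P : C"
proof -
  have "TFun B C # A # \<Gamma> \<turnstile>\<^sub>v ren_val V (\<lambda>n. Suc (Suc n)) : HTy S C"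
    by (rule ty_ren(1)[OF assms(1)]) (simp add: ren_ty_def)
  then have "TFun B C # A # \<Gamma> \<turnstile>\<^sub>v VPrj (Lab l) (ren_val V (\<lambda>n. Suc (Suc n))) : TFun (TPair A (TFun B C)) C"
    unfolding HTy_def by (rule ty_prj) (simp add: assms(2))
  then show ?thesis using assms(2,3)
    by (auto simp: fmlookup_hterm intro!: ty_app ty_pair ty_var')
qed

lemma is_arr_handle:
  "is_arr (term_handle S S' A) (TPair (HTy S (CTy A S')) (TT S (TT S' A))) (TT S' A)
     (VLam (CHandle (CApp (VSnd (VVar 1)) VUnit) (hterm S (VFst (VVar 1))) (CApp (VVar 0) VUnit)))"
proof -
  let ?G = "[TUnit, TPair (HTy S (CTy A S')) (TT S (TT S' A))]"
  have V: "?G \<turnstile>\<^sub>v VFst (VVar 1) : HTy S (CTy A S')"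
    by (rule ty_fst[OF ty_var']) simp_all
  have "?G \<turnstile>\<^sub>c CHandle (CApp (VSnd (VVar 1)) VUnit) (hterm S (VFst (VVar 1))) (CApp (VVar 0) VUnit) : CTy A S'"
    by (rule ty_handle[OF ty_run[OF ty_snd[OF ty_var']] _ ty_hterm[OF V] ty_run[OF ty_var']])
      (auto simp: hterm_def)
  then show ?thesis unfolding is_arr_def term_handle_def term_handler_eq TT_def[of S' A]
    by (auto simp: TT_def intro!: ty_lam)
qed

lemmas cred_handle_steps = red_app_head[THEN red_handle_head, THEN cred_trans, unfolded One_nat_def]
  red_handle_ret[THEN cred_trans] red_handle_let[THEN cred_trans] red_hterm cred_steps

lemmas model_is_arr = monad_is_arr is_arr_kev is_arr_handle

lemma is_arr_prj_HFam:
  assumes "fmlookup S l = Some (A, B)"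
  shows "is_arr (Prj term_cat (HFam term_cat term_kexp S S' X) (Lab l)) (HTy S (CTy X S'))
    (TFun (TPair A (TFun B (CTy X S'))) (CTy X S')) (VPrj (Lab l) (VVar 0))"
  \<comment> \<open>The first simplification folds the domain with \<open>HFam_eq\<close>, whose
    pattern mentions \<open>HFam\<close>; the second unfolds \<open>HFam\<close> to read off the
    entry at \<open>Lab l\<close>.\<close>
  using is_arr_prj[of "HFam term_cat term_kexp S S' X" "Lab l"] assms
  by (simp add: HFam_eq) (simp add: HFam_def term_kexp_def)

lemma kexp_univ_term:
  assumes "f \<in> Hom term_cat (TPair D A) (TT S B)"
  shows "\<exists>!g. g \<in> Hom term_cat D (TFun A (CTy B S)) \<and>
    term_kev S A B \<odot>\<^bsub>term_cat\<^esub> (g \<otimes>\<otimes>\<^bsub>term_cat\<^esub> Idn term_cat A) = f"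
proof -
  obtain F where FT: "[TPair D A] \<turnstile>\<^sub>v F : TT S B"
    and F: "is_arr f (TPair D A) (TT S B) (sub_val F (\<lambda>_. VVar 0))" using assms by (rule HomE)
  \<comment> \<open>Currying of \<open>f\<close>: index 0 is the argument from \<open>A\<close>,
    index 1 the parameter from \<open>D\<close>. The thunk is run because the exponential
    \<open>TFun A (CTy B S)\<close> delays the computation by its own abstraction.\<close>
  let ?g = "VLam (CApp (sub_val F (\<lambda>_. VPair (VVar 1) (VVar 0))) VUnit)"
  have g: "is_arr (arr D (TFun A (CTy B S)) ?g) D (TFun A (CTy B S)) ?g"
    unfolding is_arr_def
    by (intro conjI refl ty_lam ty_run ty_sub(1)[OF FT sub_ty1] ty_pair ty_var') simp_all
  show ?thesis
  proof (rule ex1I[of _ "arr D (TFun A (CTy B S)) ?g"], intro conjI)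
    show "arr D (TFun A (CTy B S)) ?g \<in> Hom term_cat D (TFun A (CTy B S))"
      by (rule is_arr_Hom[OF g])
    show "term_kev S A B \<odot>\<^bsub>term_cat\<^esub> (arr D (TFun A (CTy B S)) ?g \<otimes>\<otimes>\<^bsub>term_cat\<^esub> Idn term_cat A) = f"
      by (rule is_arr_thunk_eqI', (rule model_is_arr F g)+,
          ((simp add: inst_def)?, rule cred_handle_steps)+,
        (rule run_cong subst1_eq[OF veq_refl[OF FT]] eta_pair' ty_var')+, simp_all)
  next
    fix h assume h: "h \<in> Hom term_cat D (TFun A (CTy B S)) \<and>
      term_kev S A B \<odot>\<^bsub>term_cat\<^esub> (h \<otimes>\<otimes>\<^bsub>term_cat\<^esub> Idn term_cat A) = f"
    then obtain G where GT: "[D] \<turnstile>\<^sub>v G : TFun A (CTy B S)"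
      and G: "is_arr h D (TFun A (CTy B S)) (sub_val G (\<lambda>_. VVar 0))" by (blast elim: HomE)
    \<comment> \<open>Evaluating the composite assumed equal to \<open>f\<close> gives a second
      representative of \<open>f\<close>, whence the equation \<open>E\<close> with the
      first.\<close>
    have "is_arr f (TPair D A) (TT S B)
      (VLam (CApp (sub_val G (\<lambda>_. VFst (VVar 1))) (VSnd (VVar 1))))"
      unfolding conjunct2[OF h, symmetric]
      by (rule is_arr_red_eq, (rule model_is_arr G)+,
          ((simp add: inst_def)?, rule cred_handle_steps)+, simp)
    from is_arr_veq[OF F this] have E: "[TPair D A] \<turnstile>\<^sub>v sub_val F (\<lambda>_. VVar 0) \<approx>
      VLam (CApp (sub_val G (\<lambda>_. VFst (VVar 1))) (VSnd (VVar 1))) : TT S B" .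
    \<comment> \<open>Putting the pair of the two context variables into \<open>E\<close> and
      running both sides equates the body of \<open>?g\<close> with the body of the eta-expansion of
      \<open>G\<close>; abstraction and function eta finish uniqueness.\<close>
    have P: "[A, D] \<turnstile>\<^sub>v VPair (VVar 1) (VVar 0) : TPair D A"
      by (intro ty_pair ty_var') simp_all
    have "[A, D] \<turnstile>\<^sub>c CApp (sub_val F (\<lambda>_. VPair (VVar 1) (VVar 0))) VUnit \<approx>
      CApp (VLam (CApp (sub_val G (\<lambda>_. VFst (VPair (VVar 2) (VVar 1)))) (VSnd (VPair (VVar 2) (VVar 1))))) VUnit : CTy B S"
      using run_cong[OF subst1_eq[OF E veq_refl[OF P]]] by (simp add: numeral_eq_Suc)
    moreover have "cred (CApp (VLam (CApp (sub_val G (\<lambda>_. VFst (VPair (VVar 2) (VVar 1)))) (VSnd (VPair (VVar 2) (VVar 1))))) VUnit)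
      (CApp (sub_val G (\<lambda>_. VVar 1)) (VVar 0))"
      by ((simp add: inst_def)?, rule cred_handle_steps)+
    ultimately have "[A, D] \<turnstile>\<^sub>c CApp (sub_val F (\<lambda>_. VPair (VVar 1) (VVar 0))) VUnit \<approx>
      CApp (sub_val G (\<lambda>_. VVar 1)) (VVar 0) : CTy B S"
      by (meson red_sound(2) ceq_trans eq_typed(2))
    then have "[D] \<turnstile>\<^sub>v ?g \<approx> VLam (CApp (sub_val G (\<lambda>_. VVar 1)) (VVar 0)) : TFun A (CTy B S)"
      by (rule cong_lam)
    moreover have "[D] \<turnstile>\<^sub>v sub_val G (\<lambda>_. VVar 0) \<approx> VLam (CApp (sub_val G (\<lambda>_. VVar 1)) (VVar 0)) : TFun A (CTy B S)"
      using eta_fun[OF is_arr_ty[OF G]] by simp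
    ultimately show "h = arr D (TFun A (CTy B S)) ?g"
      by (intro is_arr_unique[OF G g]) (blast intro: veq_sym veq_trans)
  qed
qed

theorem theorem4p8:
  shows "(\<forall>S :: 'l sig. strong_kleisli_triple term_cat (term_triple S)) \<and>
    lam_eff_model (term_cat :: ('l ty, 'l tarr, 'l) cart)
      (\<lambda>S. smonad_of term_cat (term_triple S))
      term_kexp term_kev term_op term_handle"
proof (intro conjI allI kleisli_term_triple lam_eff_model.intro cartesian_term_cat lam_eff_model_axioms.intro,
    unfold Obj_term_cat Bin_term_cat One_term_cat TO_smonad Swap_def Prd_term_cat HFam_eq)
  fix S :: "'l sig"
  show "strong_monad term_cat (tmonad S)" by (rule strong_monad_term)
next
  fix S :: "'l sig" and A B
  show "term_kev S A B \<in> Hom term_cat (TPair (term_kexp S A B) A) (TT S B)"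
    unfolding term_kexp_def by (rule is_arr_Hom[OF is_arr_kev])
next
  fix S :: "'l sig" and A B D f assume "f \<in> Hom term_cat (TPair D A) (TT S B)"
  then show "\<exists>!g. g \<in> Hom term_cat D (term_kexp S A B) \<and> term_kev S A B \<odot>\<^bsub>term_cat\<^esub> (g \<otimes>\<otimes>\<^bsub>term_cat\<^esub> Idn term_cat A) = f"
    unfolding term_kexp_def by (rule kexp_univ_term)
next
  fix S :: "'l sig" and l A B assume "fmlookup S l = Some (A, B)"
  then show "term_op S l \<in> Hom term_cat A (TT S B)" by (rule is_arr_Hom[OF is_arr_opr])
next
  fix S S' :: "'l sig" and X
  show "term_handle S S' X \<in> Hom term_cat (TPair (HTy S (CTy X S')) (TT S (TT S' X))) (TT S' X)"
    by (rule is_arr_Hom[OF is_arr_handle])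
next
  fix S S' :: "'l sig" and X H assume H: "H = HTy S (CTy X S')"
  show "term_handle S S' X \<odot>\<^bsub>term_cat\<^esub> (Idn term_cat H \<otimes>\<otimes>\<^bsub>term_cat\<^esub> Eta (tmonad S) (TT S' X)) = Snd term_cat H (TT S' X)"
    unfolding H
    by (rule is_arr_thunk_eqI, (rule model_is_arr)+,
        ((simp add: inst_def)?, rule cred_handle_steps)+, simp)
next
  fix S S' :: "'l sig" and X H Y assume H: "H = HTy S (CTy X S')" "Y = TT S (TT S' X)"
  show "term_handle S S' X \<odot>\<^bsub>term_cat\<^esub> (Idn term_cat H \<otimes>\<otimes>\<^bsub>term_cat\<^esub> Mu (tmonad S) (TT S' X)) =
       term_handle S S' X \<odot>\<^bsub>term_cat\<^esub> (Idn term_cat H \<otimes>\<otimes>\<^bsub>term_cat\<^esub> TM (tmonad S) (term_handle S S' X)) \<odot>\<^bsub>term_cat\<^esub>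
       \<langle>Fst term_cat H (TT S Y), Str (tmonad S) H Y\<rangle>\<^bsub>term_cat\<^esub>"
    unfolding H
    \<comment> \<open>\<open>red_handle_let\<close> turns the lets on both sides into nested
      handles. On the right, the handle thunked by \<open>TM\<close> is run by the return clause and
      becomes the inner handle found on the left.\<close>
    by (rule is_arr_thunk_eqI, (rule model_is_arr)+,
        ((simp add: inst_def)?, rule cred_handle_steps)+, simp)
next
  fix S S' :: "'l sig" and X l A B H E a
  assume l: "fmlookup S l = Some (A, B)" and H: "H = HTy S (CTy X S')" "E = term_kexp S' B X"
    "a = TM (tmonad S) (term_kev S' B X) \<odot>\<^bsub>term_cat\<^esub> Str (tmonad S) E B \<odot>\<^bsub>term_cat\<^esub>
         \<langle>Snd term_cat (TT S B) E, Fst term_cat (TT S B) E\<rangle>\<^bsub>term_cat\<^esub> \<odot>\<^bsub>term_cat\<^esub> (term_op S l \<otimes>\<otimes>\<^bsub>term_cat\<^esub> Idn term_cat E)"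
  \<comment> \<open>The two reducts of the operation law apply the same component of the handler
    family, the left one to a rebuilt pair whose second entry is an eta-expanded continuation.
    Function eta restores that entry, then surjective pairing the whole argument.\<close>
  have ev: "[TPair (HTy S (CTy X S')) (TPair A (TFun B (CTy X S')))] \<turnstile>\<^sub>v
      VPair (VPrj (Num (Suc 0)) (VSnd (VVar 0))) (VLam (CApp (VSnd (VSnd (VVar (Suc 0)))) (VVar 0))) \<approx> VSnd (VVar 0)
      : TPair A (TFun B (CTy X S'))" (is "?G \<turnstile>\<^sub>v _ \<approx> _ : _")
  proof -
    have x: "?G \<turnstile>\<^sub>v VSnd (VVar 0) : TPair A (TFun B (CTy X S'))"
      by (rule ty_snd[OF ty_var']) simp_all
    have "?G \<turnstile>\<^sub>v VLam (CApp (VSnd (VSnd (VVar (Suc 0)))) (VVar 0)) \<approx> VSnd (VSnd (VVar 0)) : TFun B (CTy X S')"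
      using veq_sym[OF eta_fun[OF ty_snd[OF x]]] by simp
    then show ?thesis
      by (intro veq_trans[OF cong_pair eta_pair'[OF x]] veq_refl ty_fst'[OF x])
  qed
  have opl: "[TPair (HTy S (CTy X S')) (TPair A (TFun B (CTy X S')))] \<turnstile>\<^sub>v VPrj (Lab l) (VPrj (Num (Suc 0)) (VVar 0))
      : TFun (TPair A (TFun B (CTy X S'))) (CTy X S')"
    by (rule ty_prj[OF ty_fst'[OF ty_var'[where A="TPair (HTy S (CTy X S')) (TPair A (TFun B (CTy X S')))", unfolded HTy_def]]])
      (simp_all add: HTy_def l)
  show "term_handle S S' X \<odot>\<^bsub>term_cat\<^esub> (Idn term_cat H \<otimes>\<otimes>\<^bsub>term_cat\<^esub> a) =
    term_kev S' (TPair A E) X \<odot>\<^bsub>term_cat\<^esub>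
      (Prj term_cat (HFam term_cat term_kexp S S' X) (Lab l) \<otimes>\<otimes>\<^bsub>term_cat\<^esub> Idn term_cat (TPair A E))"
    unfolding H term_kexp_def
    \<comment> \<open>Splitting the lets leaves \<open>COp\<close> under the outermost handle; its
      return clause contains the remaining handles, is abstracted into the continuation by
      \<open>red_handle_op\<close>, and reduces there to the application of the given
      continuation.\<close>
    by (rule is_arr_thunk_eqI', (rule is_arr_prj_HFam[OF l, unfolded term_kexp_def] model_is_arr is_arr_opr[OF l])+,
        ((simp add: inst_def inst2_def)?, rule red_handle_op[OF fmlookup_hterm[OF l], THEN cred_trans] cred_handle_steps)+, rule cong_app[OF veq_refl[OF opl] ev])
qed auto

end
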